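(* Let $G=(V,D,B)$ be a mixed graph, $v\in V$, $w_0\to v\in G$, and suppose the edges $w_1\to v,\dots,w_\ell\to v\in G$ (with $\ell\ge0$ and $w_0,\dots,w_\ell$ distinct) are generically (respectively, rationally) identifiable. Let $G^*_{\mathrm{flow}}$ be $G_{\mathrm{flow}}$ with the edges $w_0'\to v',\dots,w_\ell'\to v'$ removed. Suppose there are sets $S\subset V$ and $T\subset V\setminus\{v,w_0\}$ with $|S|=|T|+1=k$ such that: (a) $\mathrm{des}(v)\cap(T\cup\{v\})=\emptyset$; (b) the maximum flow from $S$ to $T'\cup\{w_0'\}$ in $G_{\mathrm{flow}}$ equals $k$; (c) the maximum flow from $S$ to $T'\cup\{v'\}$ in $G^*_{\mathrm{flow}}$ is less than $k$. Then $w_0\to v$ is generically (respectively, rationally) identifiable, by the equation $$\lambda_{w_0v}=\frac{|\Sigma_{S,T\cup\{v\}}|-\sum_{i=1}^{\ell}\lambda_{w_iv}|\Sigma_{S,T\cup\{w_i\}}|}{|\Sigma_{S,T\cup\{w_0\}}|},$$ where $\Sigma=\phi_G(\Lambda,\Omega)$ and $|\cdot|$ denotes the determinant (rows and columns ordered compatibly).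
   Context: A mixed graph $G=(V,D,B)$ on $V=\{1,\dots,n\}$ has directed edges $D\subset V\times V$ ($v\to w\in G$ iff $(v,w)\in D$) and symmetric bidirected edges $B$ ($v\leftrightarrow w\in G$ iff $(v,w)\in B$), no self-loops. $\mathrm{des}(v)$ is the set of $w$ such that there is a non-empty directed path from $v$ to $w$. $\mathbb{R}^D_{\mathrm{reg}}$ is the set of real $n\times n$ matrices $\Lambda$ supported on $D$ with $I-\Lambda$ invertible; $PD(B)$ is the set of positive definite $\Omega$ with $\omega_{vw}=0$ for $v\ne w$ unless $v\leftrightarrow w\in G$. $\Theta=\mathbb{R}^D_{\mathrm{reg}}\times PD(B)$, $\phi_G(\Lambda,\Omega)=(I-\Lambda)^{-T}\Omega(I-\Lambda)^{-1}$. An edge $u\to w$ is generically identifiable if there is a proper algebraic subset $A\subset\Theta$ such that for all $(\Lambda,\Omega)\in\Theta\setminus A$, every $(\tilde\Lambda,\tilde\Omega)\in\Theta$ with $\phi_G(\tilde\Lambda,\tilde\Omega)=\phi_G(\Lambda,\Omega)$ has $\tilde\lambda_{uw}=\lambda_{uw}$; rationally identifiable if there is a rational function $\psi$ and proper algebraic $A\subset\Theta$ with $\psi(\phi_G(\Lambda,\Omega))=\lambda_{uw}$ on $\Theta\setminus A$. $G_{\mathrm{flow}}$ is the directed graph on $\{1,\dots,n\}\cup\{1',\dots,n'\}$ with edges $i\to j$ whenever $j\to i\in G$, $i\to i'$ for all $i$, $i\to j'$ whenever $i\leftrightarrow j\in G$, and $i'\to j'$ whenever $i\to j\in G$, all vertices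 and edges of capacity $1$; $T'=\{t':t\in T\}$. Maximum flows allow multiple sources/sinks and vertex capacities. *)

theory Defs
  imports Complex_Main "Jordan_Normal_Form.Determinant" "Jordan_Normal_Form.Gauss_Jordan_Elimination"
begin

definition mixed_graph :: "nat \<Rightarrow> (nat \<times> nat) set \<Rightarrow> (nat \<times> nat) set \<Rightarrow> bool" where
  "mixed_graph n D B \<longleftrightarrow> D \<subseteq> {0..<n} \<times> {0..<n} \<and> B \<subseteq> {0..<n} \<times> {0..<n}
     \<and> (\<forall>v. (v,v) \<notin> D) \<and> (\<forall>v. (v,v) \<notin> B) \<and> (\<forall>v w. (v,w) \<in> B \<longrightarrow> (w,v) \<in> B)"

definition des :: "(nat \<times> nat) set \<Rightarrow> nat \<Rightarrow> nat set" where
  "des D v = {w. (v,w) \<in> D\<^sup>+}"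

definition pos_def_mat :: "nat \<Rightarrow> real mat \<Rightarrow> bool" where
  "pos_def_mat n M \<longleftrightarrow> M \<in> carrier_mat n n \<and> M\<^sup>T = M \<and>
     (\<forall>x \<in> carrier_vec n. x \<noteq> 0\<^sub>v n \<longrightarrow> x \<bullet> (M *\<^sub>v x) > 0)"

definition RD_reg :: "nat \<Rightarrow> (nat \<times> nat) set \<Rightarrow> real mat set" where
  "RD_reg n D = {L. L \<in> carrier_mat n n \<and> (\<forall>i<n. \<forall>j<n. (i,j) \<notin> D \<longrightarrow> L $$ (i,j) = 0)
                    \<and> invertible_mat (1\<^sub>m n - L)}"

definition PD_B :: "nat \<Rightarrow> (nat \<times> nat) set \<Rightarrow> real mat set" where
  "PD_B n B = {Om. pos_def_mat n Om \<and> (\<forall>i<n. \<forall>j<n. i \<noteq> j \<and> (i,j) \<notin> B \<longrightarrow> Om $$ (i,j) = 0)}"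

definition Theta :: "nat \<Rightarrow> (nat \<times> nat) set \<Rightarrow> (nat \<times> nat) set \<Rightarrow> (real mat \<times> real mat) set" where
  "Theta n D B = RD_reg n D \<times> PD_B n B"

definition mat_inv :: "real mat \<Rightarrow> real mat" where
  "mat_inv A = the (mat_inverse A)"

definition phiG :: "nat \<Rightarrow> real mat \<times> real mat \<Rightarrow> real mat" where
  "phiG n \<theta> = (mat_inv (1\<^sub>m n - fst \<theta>))\<^sup>T * snd \<theta> * mat_inv (1\<^sub>m n - fst \<theta>)"

inductive polyfun :: "('x \<Rightarrow> 'i \<Rightarrow> real) \<Rightarrow> ('x \<Rightarrow> real) \<Rightarrow> bool" for c where
  pconst: "polyfun c (\<lambda>x. a)"
| pvar: "polyfun c (\<lambda>x. c x i)"
| padd: "polyfun c p \<Longrightarrow> polyfun c q \<Longrightarrow> polyfun c (\<lambda>x. p x + q x)"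
| pmult: "polyfun c p \<Longrightarrow> polyfun c q \<Longrightarrow> polyfun c (\<lambda>x. p x * q x)"

definition param_coords :: "real mat \<times> real mat \<Rightarrow> bool \<times> nat \<times> nat \<Rightarrow> real" where
  "param_coords \<theta> = (\<lambda>(b,i,j). if b then fst \<theta> $$ (i,j) else snd \<theta> $$ (i,j))"

definition mat_coords :: "real mat \<Rightarrow> nat \<times> nat \<Rightarrow> real" where
  "mat_coords M = (\<lambda>(i,j). M $$ (i,j))"

definition algebraic_subset :: "(real mat \<times> real mat) set \<Rightarrow> (real mat \<times> real mat) set \<Rightarrow> bool" where
  "algebraic_subset \<Theta> A \<longleftrightarrow> (\<exists>F. finite F \<and> (\<forall>f\<in>F. polyfun param_coords f) \<and>
       A = {\<theta>\<in>\<Theta>. \<forall>f\<in>F. f \<theta> = 0})"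

definition proper_algebraic_subset where
  "proper_algebraic_subset \<Theta> A \<longleftrightarrow> algebraic_subset \<Theta> A \<and> A \<noteq> \<Theta>"

definition generically_identifiable :: "nat \<Rightarrow> (nat \<times> nat) set \<Rightarrow> (nat \<times> nat) set \<Rightarrow> nat \<Rightarrow> nat \<Rightarrow> bool" where
  "generically_identifiable n D B u w \<longleftrightarrow> (\<exists>A. proper_algebraic_subset (Theta n D B) A \<and>
     (\<forall>\<theta> \<in> Theta n D B - A. \<forall>\<theta>' \<in> Theta n D B.
        phiG n \<theta>' = phiG n \<theta> \<longrightarrow> fst \<theta>' $$ (u,w) = fst \<theta> $$ (u,w)))"

definition rationally_identifiable :: "nat \<Rightarrow> (nat \<times> nat) set \<Rightarrow> (nat \<times> nat) set \<Rightarrow> nat \<Rightarrow> nat \<Rightarrow> bool" where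
  "rationally_identifiable n D B u w \<longleftrightarrow> (\<exists>p q A. polyfun mat_coords p \<and> polyfun mat_coords q \<and>
     proper_algebraic_subset (Theta n D B) A \<and>
     (\<forall>\<theta> \<in> Theta n D B - A. q (phiG n \<theta>) \<noteq> 0 \<and> p (phiG n \<theta>) / q (phiG n \<theta>) = fst \<theta> $$ (u,w)))"

text \<open>Vertices of G_flow: Inl i is i, Inr i is i'.\<close>
definition Gflow_edges :: "nat \<Rightarrow> (nat \<times> nat) set \<Rightarrow> (nat \<times> nat) set \<Rightarrow> ((nat + nat) \<times> (nat + nat)) set" where
  "Gflow_edges n D B =
     {(Inl i, Inl j) | i j. (j,i) \<in> D} \<union> {(Inl i, Inr i) | i. i < n} \<union>
     {(Inl i, Inr j) | i j. (i,j) \<in> B} \<union> {(Inr i, Inr j) | i j. (i,j) \<in> D}"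

definition Gflow_verts :: "nat \<Rightarrow> (nat + nat) set" where
  "Gflow_verts n = Inl ` {0..<n} \<union> Inr ` {0..<n}"

datatype 'a fnode = Src | Snk | Nd 'a

text \<open>Multiple sources/sinks via a super source and super sink.\<close>
definition aug_edges :: "('a \<times> 'a) set \<Rightarrow> 'a set \<Rightarrow> 'a set \<Rightarrow> ('a fnode \<times> 'a fnode) set" where
  "aug_edges E S T = {(Nd a, Nd b) | a b. (a,b) \<in> E} \<union> {(Src, Nd s) | s. s \<in> S} \<union> {(Nd t, Snk) | t. t \<in> T}"

definition aug_verts :: "'a set \<Rightarrow> 'a fnode set" where
  "aug_verts W = insert Src (insert Snk (Nd ` W))"

definition is_flow :: "'a set \<Rightarrow> ('a \<times> 'a) set \<Rightarrow> 'a set \<Rightarrow> 'a set \<Rightarrow> ('a fnode \<times> 'a fnode \<Rightarrow> real) \<Rightarrow> bool" where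
  "is_flow W E S T f \<longleftrightarrow>
     (\<forall>e. f e \<noteq> 0 \<longrightarrow> e \<in> aug_edges E S T) \<and> (\<forall>e. 0 \<le> f e \<and> f e \<le> 1) \<and>
     (\<forall>x\<in>W. (\<Sum>y\<in>aug_verts W. f (y, Nd x)) = (\<Sum>y\<in>aug_verts W. f (Nd x, y)) \<and>
             (\<Sum>y\<in>aug_verts W. f (y, Nd x)) \<le> 1)"

definition flow_value :: "'a set \<Rightarrow> ('a fnode \<times> 'a fnode \<Rightarrow> real) \<Rightarrow> real" where
  "flow_value W f = (\<Sum>y\<in>aug_verts W. f (Src, y))"

definition max_flow :: "'a set \<Rightarrow> ('a \<times> 'a) set \<Rightarrow> 'a set \<Rightarrow> 'a set \<Rightarrow> real" where
  "max_flow W E S T = Sup {flow_value W f | f. is_flow W E S T f}"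

definition subdet :: "real mat \<Rightarrow> nat list \<Rightarrow> nat list \<Rightarrow> real" where
  "subdet M rs cs = det (mat (length rs) (length cs) (\<lambda>(i,j). M $$ (rs ! i, cs ! j)))"

end

theory Submission
  imports Defs
begin

text \<open>
  Put Lw = lambda of the edge w -> v and let L* be Lambda without the entries of the edges
  w_i -> v. Since v is not a descendant of itself and T contains no descendant of v, subtracting
  from column v of Sigma the columns w_i with weights Lw turns the columns T and v of
  (I - Lambda)^(-T) Omega (I - Lambda)^(-1) into those of (I - Lambda)^(-T) Omega (I - L*)^(-1),
  which is a block of the inverse of a matrix supported on the reduced flow graph. If the maximum
  flow there is below k, this k x k minor vanishes identically, which is the displayed equation;
  if the maximum flow in the full graph is k, the minor in the denominator is not identically zero.

  Instead of vertex-disjoint paths, both directions use Hall's theorem: for sources S and sinks T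
  of equal size, a perfect matching between the non-sinks and the non-sources along loops and
  edges is a flow of value k (possibly with additional cycles), and a set violating Hall's
  condition bounds all flows by k - 1. A violating set gives, by counting unknowns and equations,
  a left null vector of the minor; a matching gives parameters where the minor does not vanish.
\<close>

section \<open>Hall violators and maximum flows\<close>

text \<open>The block matrix with rows (I - Lambda^T, -Omega) and (0, I - Lambda) is supported on
  the loops and edges of the flow graph, and the upper right block of its inverse is Sigma. By
  Jacobi's identity a minor of Sigma with rows S and columns T is, up to a nonzero factor, the
  complementary minor of this matrix: rows outside T', columns outside S. Perfect matchings index
  the possibly nonzero terms of its Leibniz expansion; this is why they can replace paths and why
  additional cycles do no harm. Null vectors take the place of Jacobi's identity itself.

  Directed cycles are allowed, so Sigma need not be polynomial in Lambda and path expansions need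
  not be finite; adjugates clear the denominators.

  The identity between the minors holds on all of Theta. Genericity is needed only for the
  denominator and for the edges already identified. Their exceptional sets can be combined because
  Theta is irreducible.\<close>

lemma hall_marriage:
  fixes A :: "'i \<Rightarrow> 'a set"
  assumes "finite I" and "\<And>i. i \<in> I \<Longrightarrow> finite (A i)"
    and "\<And>J. J \<subseteq> I \<Longrightarrow> card J \<le> card (\<Union>(A ` J))"
  shows "\<exists>f. inj_on f I \<and> (\<forall>i\<in>I. f i \<in> A i)"
  using assms
proof (induction "card I" arbitrary: I A rule: less_induct)
  case less
  note fin = less.prems(1) and finA = less.prems(2) and hall = less.prems(3)
  \<comment> \<open>Halmos-Vaughan split. A tight nonempty proper \<open>J\<close> is matched within
    its own neighbourhood, and the rest avoids that neighbourhood. Without such a \<open>J\<close>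
    every nonempty proper subset has a spare neighbour, so one index may take any value
    \<open>x\<close>.\<close>
  show ?case
  proof (cases "\<exists>J. J \<noteq> {} \<and> J \<subset> I \<and> card (\<Union>(A ` J)) = card J")
    case True
    then obtain J where J: "J \<noteq> {}" "J \<subset> I" "card (\<Union>(A ` J)) = card J" by blast
    define U where "U = \<Union>(A ` J)"
    have finJ: "finite J" using J(2) fin by (meson finite_subset psubset_imp_subset)
    have finU: "finite U" unfolding U_def using finJ finA J(2) by blast
    have "\<exists>f. inj_on f J \<and> (\<forall>i\<in>J. f i \<in> A i)"
    proof (rule less.hyps)
      show "card J < card I" using J(2) fin by (rule psubset_card_mono[rotated])
      show "finite J" by (rule finJ)
      show "finite (A i)" if "i \<in> J" for i using finA that J(2) by auto
      show "card K \<le> card (\<Union>(A ` K))" if "K \<subseteq> J" for K using hall[of K] that J(2) by auto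
    qed
    then obtain f where f: "inj_on f J" "\<forall>i\<in>J. f i \<in> A i" by blast
    have "\<exists>g. inj_on g (I - J) \<and> (\<forall>i\<in>I - J. g i \<in> A i - U)"
    proof (rule less.hyps)
      show "card (I - J) < card I"
        using J(1,2) fin by (intro psubset_card_mono) auto
      show "card K \<le> card (\<Union>i\<in>K. A i - U)" if K: "K \<subseteq> I - J" for K
      proof -
        have finK: "finite K" using K fin by (meson finite_Diff finite_subset)
        have fin': "finite (\<Union>i\<in>K. A i - U)" using finK K finA by blast
        have eq: "\<Union>(A ` (K \<union> J)) = (\<Union>i\<in>K. A i - U) \<union> U" by (auto simp: U_def)
        have "card K + card J = card (K \<union> J)"
          using K finK finJ by (subst card_Un_disjoint) auto
        also have "\<dots> \<le> card (\<Union>(A ` (K \<union> J)))" by (rule hall) (use K J(2) in blast)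
        also have "\<dots> = card (\<Union>i\<in>K. A i - U) + card U"
          unfolding eq using fin' finU by (subst card_Un_disjoint) auto
        finally show ?thesis using J(3) by (simp add: U_def)
      qed
    qed (use fin finA in auto)
    then obtain g where g: "inj_on g (I - J)" "\<forall>i\<in>I - J. g i \<in> A i - U" by blast
    define h where "h = (\<lambda>i. if i \<in> J then f i else g i)"
    have fU: "f i \<in> U" if "i \<in> J" for i using f that by (auto simp: U_def)
    have gU: "g i \<notin> U" if "i \<in> I" "i \<notin> J" for i using g that by auto
    have "inj_on h I"
    proof (rule inj_onI)
      fix x y assume xy: "x \<in> I" "y \<in> I" "h x = h y"
      then have "x \<in> J \<longleftrightarrow> y \<in> J" using fU gU by (metis h_def)
      then show "x = y" using xy f(1) g(1)
        by (cases "x \<in> J") (simp_all add: h_def inj_on_eq_iff)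
    qed
    moreover have "\<forall>i\<in>I. h i \<in> A i" using f(2) g(2) by (auto simp: h_def)
    ultimately show ?thesis by blast
  next
    case no_tight: False
    show ?thesis
    proof (cases "I = {}")
      case True then show ?thesis by simp
    next
      case False
      then obtain i0 where i0: "i0 \<in> I" by blast
      have "card {i0} \<le> card (\<Union>(A ` {i0}))" by (rule hall) (use i0 in auto)
      then obtain x where x: "x \<in> A i0" by (cases "A i0 = {}") auto
      have "\<exists>f. inj_on f (I - {i0}) \<and> (\<forall>i\<in>I - {i0}. f i \<in> A i - {x})"
      proof (rule less.hyps)
        show "card (I - {i0}) < card I" by (rule card_Diff1_less[OF fin i0])
        show "card K \<le> card (\<Union>i\<in>K. A i - {x})" if K: "K \<subseteq> I - {i0}" for K
        proof (cases "K = {}")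
          case False
          have "K \<subset> I" using K i0 by auto
          then have "card K \<le> card (\<Union>(A ` K))" "card (\<Union>(A ` K)) \<noteq> card K"
            using hall[of K] no_tight False by auto
          then have "card K < card (\<Union>(A ` K))" by simp
          moreover have "(\<Union>i\<in>K. A i - {x}) = \<Union>(A ` K) - {x}" by auto
          moreover have "finite (\<Union>(A ` K))" 
            using \<open>K \<subset> I\<close> fin finA by (intro finite_UN_I) (auto intro: finite_subset)
          ultimately show ?thesis by (simp add: card_Diff_singleton_if) linarith
        qed simp
      qed (use fin finA in auto)
      then obtain f where f: "inj_on f (I - {i0})" "\<forall>i\<in>I - {i0}. f i \<in> A i - {x}" by blast
      have "inj_on (f(i0 := x)) I" "\<forall>i\<in>I. (f(i0 := x)) i \<in> A i"
        using f x by (auto simp: inj_on_def)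
      then show ?thesis by blast
    qed
  qed
qed

text \<open>Loops join the edges because a vertex off every path must be matched to itself. Hall's
  theorem yields only an injection; it is onto because \<open>S\<close> and \<open>T\<close> have
  equal size.\<close>

lemma matching_or_hall_violator:
  assumes W: "finite W" and E: "E \<subseteq> W \<times> W" and S: "S \<subseteq> W" and T: "T \<subseteq> W" and k: "card S = card T"
  shows "(\<exists>\<sigma>. bij_betw \<sigma> (W - T) (W - S) \<and> (\<forall>r\<in>W - T. \<sigma> r = r \<or> (r, \<sigma> r) \<in> E))
    \<or> (\<exists>R. R \<subseteq> W - T \<and> card ((R \<union> E `` R) - S) < card R)"
proof (cases "\<exists>R. R \<subseteq> W - T \<and> card ((R \<union> E `` R) - S) < card R")
  case False
  define A where "A = (\<lambda>r. ({r} \<union> E `` {r}) - S)"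
  have AW: "A r \<subseteq> W - S" if "r \<in> W - T" for r using that E by (auto simp: A_def)
  have UA: "\<Union>(A ` R) = (R \<union> E `` R) - S" for R by (auto simp: A_def)
  have "\<exists>f. inj_on f (W - T) \<and> (\<forall>i\<in>W - T. f i \<in> A i)"
  proof (rule hall_marriage)
    show "finite (A i)" if "i \<in> W - T" for i using AW[OF that] W by (auto intro: finite_subset)
    show "card J \<le> card (\<Union>(A ` J))" if "J \<subseteq> W - T" for J
      unfolding UA using False that by (meson not_less)
  qed (use W in auto)
  then obtain f where f: "inj_on f (W - T)" "\<forall>i\<in>W - T. f i \<in> A i" by blast
  have "f ` (W - T) = W - S"
  proof (rule card_subset_eq)
    show "f ` (W - T) \<subseteq> W - S" using f(2) AW by blast
    show "card (f ` (W - T)) = card (W - S)"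
      using W S T k by (simp add: card_image[OF f(1)] card_Diff_subset finite_subset)
  qed (use W in auto)
  then have "bij_betw f (W - T) (W - S)" using f(1) by (simp add: bij_betw_def)
  moreover have "\<forall>r\<in>W - T. f r = r \<or> (r, f r) \<in> E" using f(2) by (auto simp: A_def)
  ultimately show ?thesis by blast
qed blast

section \<open>Flows with a super source and a super sink\<close>

lemma sum_aug_verts: "finite W \<Longrightarrow> sum g (aug_verts W) = g Src + g Snk + (\<Sum>x\<in>W. g (Nd x))"
  by (simp add: aug_verts_def sum.reindex inj_on_def image_iff add.assoc)

lemma flow_inflow:
  assumes "finite W" "is_flow W E S T f"
  shows "(\<Sum>y\<in>aug_verts W. f (y, Nd x)) = f (Src, Nd x) + (\<Sum>y\<in>W. f (Nd y, Nd x))"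
proof -
  have "f (Snk, Nd x) = 0" using assms(2) by (auto simp: is_flow_def aug_edges_def)
  then show ?thesis by (simp add: sum_aug_verts assms(1))
qed

lemma flow_outflow:
  assumes "finite W" "is_flow W E S T f"
  shows "(\<Sum>y\<in>aug_verts W. f (Nd x, y)) = f (Nd x, Snk) + (\<Sum>y\<in>W. f (Nd x, Nd y))"
proof -
  have "f (Nd x, Src) = 0" using assms(2) by (auto simp: is_flow_def aug_edges_def)
  then show ?thesis by (simp add: sum_aug_verts assms(1))
qed

lemma flow_value_eq:
  assumes "finite W" "S \<subseteq> W" "is_flow W E S T f"
  shows "flow_value W f = (\<Sum>s\<in>S. f (Src, Nd s))"
proof -
  have 0: "f (Src, Src) = 0" "f (Src, Snk) = 0" "\<And>x. x \<notin> S \<Longrightarrow> f (Src, Nd x) = 0"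
    using assms(3) by (auto simp: is_flow_def aug_edges_def)
  have "flow_value W f = (\<Sum>x\<in>W. f (Src, Nd x))"
    using 0 by (simp add: flow_value_def sum_aug_verts assms(1))
  also have "\<dots> = (\<Sum>s\<in>S. f (Src, Nd s))"
    using assms(1,2) 0 by (intro sum.mono_neutral_right) auto
  finally show ?thesis .
qed

lemma flow_value_le_card:
  assumes "finite W" "S \<subseteq> W" "is_flow W E S T f"
  shows "flow_value W f \<le> card S"
proof -
  have "(\<Sum>s\<in>S. f (Src, Nd s)) \<le> (\<Sum>s\<in>S. 1)"
    using assms(3) by (intro sum_mono) (auto simp: is_flow_def)
  then show ?thesis using flow_value_eq[OF assms] by simp
qed

lemma max_flow_of_matching:
  assumes W: "finite W" and S: "S \<subseteq> W" and T: "T \<subseteq> W"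
    and bij: "bij_betw \<sigma> (W - T) (W - S)" and edge: "\<forall>r\<in>W - T. \<sigma> r = r \<or> (r, \<sigma> r) \<in> E"
  shows "real (card S) \<le> max_flow W E S T"
proof -
  \<comment> \<open>Proper edges of \<open>\<sigma>\<close> carry one unit and fixed points carry
    nothing. A cycle of \<open>\<sigma>\<close> becomes a circulation, which adds nothing to the
    value.\<close>
  define f :: "'a fnode \<times> 'a fnode \<Rightarrow> real" where "f = (\<lambda>(x,y). case (x,y) of
      (Src, Nd s) \<Rightarrow> of_bool (s \<in> S)
    | (Nd t, Snk) \<Rightarrow> of_bool (t \<in> T)
    | (Nd a, Nd b) \<Rightarrow> of_bool (a \<in> W - T \<and> b = \<sigma> a \<and> b \<noteq> a)
    | _ \<Rightarrow> 0)"
  have f_simps [simp]: "f (Src, Nd s) = of_bool (s \<in> S)" "f (Nd t, Snk) = of_bool (t \<in> T)"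
    "f (Snk, y) = 0" "f (y, Src) = 0"
    "f (Nd a, Nd b) = of_bool (a \<in> W - T \<and> b = \<sigma> a \<and> b \<noteq> a)" for s t a b y
    by (auto simp: f_def split: fnode.splits)
  have f01: "0 \<le> f e \<and> f e \<le> 1" for e
    by (cases e) (auto simp: f_def split: fnode.splits)
  have supp: "e \<in> aug_edges E S T" if "f e \<noteq> 0" for e
    using that edge by (cases e) (auto simp: f_def aug_edges_def split: fnode.splits)
  have range: "\<sigma> y \<in> W - S" if "y \<in> W - T" for y using bij that by (auto simp: bij_betw_def)
  \<comment> \<open>Inflow and outflow equal the same indicator: only a fixed point that is neither
    source nor sink is idle. A source is never in the range of \<open>\<sigma>\<close>, and every
    other vertex has exactly one preimage.\<close>
  have inflow: "(\<Sum>y\<in>aug_verts W. f (y, Nd x)) = of_bool (\<not> (x \<notin> S \<and> x \<notin> T \<and> \<sigma> x = x))"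
    if x: "x \<in> W" for x
  proof (cases "x \<in> S")
    case True
    have "(\<Sum>y\<in>W. f (Nd y, Nd x)) = 0"
      using True range by (intro sum.neutral ballI) auto
    then show ?thesis using True by (simp add: sum_aug_verts W)
  next
    case False
    then have "x \<in> \<sigma> ` (W - T)" using bij x by (simp add: bij_betw_def)
    then obtain y0 where y0: "y0 \<in> W - T" "\<sigma> y0 = x" by blast
    have uniq: "y \<in> W - T \<and> x = \<sigma> y \<longleftrightarrow> y = y0" for y
      using bij y0 unfolding bij_betw_def inj_on_def by blast
    have "f (Nd y, Nd x) = (if y = y0 then of_bool (x \<noteq> y0) else 0)" for y
      unfolding f_simps using uniq[of y] by (cases "y = y0") auto
    then have "(\<Sum>y\<in>W. f (Nd y, Nd x)) = (\<Sum>y\<in>W. if y = y0 then of_bool (x \<noteq> y0) else 0)"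
      by (simp only:)
    also have "\<dots> = of_bool (x \<noteq> y0)" using y0 W by simp
    finally have "(\<Sum>y\<in>W. f (Nd y, Nd x)) = of_bool (x \<noteq> y0)" .
    moreover have "x \<noteq> y0 \<longleftrightarrow> \<not> (x \<notin> T \<and> \<sigma> x = x)" using uniq[of x] x by (metis DiffE DiffI)
    ultimately show ?thesis using False by (simp add: sum_aug_verts W)
  qed
  have outflow: "(\<Sum>y\<in>aug_verts W. f (Nd x, y)) = of_bool (\<not> (x \<notin> S \<and> x \<notin> T \<and> \<sigma> x = x))"
    if x: "x \<in> W" for x
  proof (cases "x \<in> T")
    case True
    then have "(\<Sum>y\<in>W. f (Nd x, Nd y)) = 0" by (intro sum.neutral ballI) auto
    then show ?thesis using True by (simp add: sum_aug_verts W)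
  next
    case False
    have "(\<Sum>y\<in>W. f (Nd x, Nd y)) = (\<Sum>y\<in>W. if y = \<sigma> x then of_bool (\<sigma> x \<noteq> x) else 0)"
      using False x by (intro sum.cong refl) auto
    also have "\<dots> = of_bool (\<sigma> x \<noteq> x)" using False x W range[of x] by simp
    finally have "(\<Sum>y\<in>W. f (Nd x, Nd y)) = of_bool (\<sigma> x \<noteq> x)" .
    then have "(\<Sum>y\<in>aug_verts W. f (Nd x, y)) = of_bool (\<sigma> x \<noteq> x)"
      using False by (simp add: sum_aug_verts W)
    also have "\<dots> = of_bool (\<not> (x \<notin> S \<and> x \<notin> T \<and> \<sigma> x = x))"
      using False x range[of x] by auto
    finally show ?thesis .
  qed
  have flow: "is_flow W E S T f"
    unfolding is_flow_def using supp f01 inflow outflow by auto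
  have "flow_value W f = card S"
    by (simp add: flow_value_eq[OF W S flow])
  moreover have "bdd_above {flow_value W f | f. is_flow W E S T f}"
    using flow_value_le_card[OF W S] by (intro bdd_aboveI[of _ "real (card S)"]) auto
  ultimately show ?thesis
    unfolding max_flow_def using flow by (intro cSup_upper) (auto intro!: exI[of _ f])
qed

text \<open>No vertex of \<open>R\<close> is a sink, so whatever enters \<open>R\<close> flows on
  into \<open>N\<close>, the set \<open>R\<close> together with its successors. The capacities of
  \<open>N\<close> thus leave at most \<open>card N - card R\<close> units for the sources in
  \<open>N\<close>; the other sources bring at most \<open>card (S - N)\<close>. The violation makes
  the sum smaller than \<open>card S\<close>, by at least 1 since only integers are compared, so the
  supremum over fractional flows is strictly smaller too.\<close>

lemma max_flow_hall_violator:
  assumes W: "finite W" and E: "E \<subseteq> W \<times> W" and S: "S \<subseteq> W" and R: "R \<subseteq> W - T"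
    and viol: "card ((R \<union> E `` R) - S) < card R"
  shows "max_flow W E S T < card S"
proof -
  define N where "N = R \<union> E `` R"
  have NW: "N \<subseteq> W" using R E by (auto simp: N_def)
  have fin: "finite N" "finite R" "finite S"
    using NW W R S by (auto intro: finite_subset)
  have "flow_value W f \<le> real (card S) - 1" if f: "is_flow W E S T f" for f
  proof -
    define inf where "inf = (\<lambda>x. \<Sum>y\<in>aug_verts W. f (y, Nd x))"
    define I where "I = (\<lambda>x. \<Sum>y\<in>W. f (Nd y, Nd x))"
    have pos: "0 \<le> f e" "f e \<le> 1" for e using f unfolding is_flow_def by blast+
    have inf: "inf x = f (Src, Nd x) + I x" for x
      unfolding inf_def I_def by (rule flow_inflow[OF W f])
    have inf1: "inf x \<le> 1" if "x \<in> W" for x using f that by (auto simp: is_flow_def inf_def)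
    have "sum inf R = (\<Sum>x\<in>R. \<Sum>y\<in>N. f (Nd x, Nd y))"
    proof (rule sum.cong[OF refl])
      fix x assume x: "x \<in> R"
      have "inf x = (\<Sum>y\<in>aug_verts W. f (Nd x, y))"
        using f x R by (auto simp: is_flow_def inf_def)
      also have "\<dots> = f (Nd x, Snk) + (\<Sum>y\<in>W. f (Nd x, Nd y))" by (rule flow_outflow[OF W f])
      also have "f (Nd x, Snk) = 0" using f x R by (auto simp: is_flow_def aug_edges_def)
      also have "(\<Sum>y\<in>W. f (Nd x, Nd y)) = (\<Sum>y\<in>N. f (Nd x, Nd y))"
      proof (rule sum.mono_neutral_right[OF W NW], intro ballI)
        fix y assume "y \<in> W - N"
        then have "(x,y) \<notin> E" using x by (auto simp: N_def)
        then have "(Nd x, Nd y) \<notin> aug_edges E S T" by (auto simp: aug_edges_def)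
        then show "f (Nd x, Nd y) = 0" using f by (auto simp: is_flow_def)
      qed
      finally show "inf x = (\<Sum>y\<in>N. f (Nd x, Nd y))" by simp
    qed
    also have "\<dots> = (\<Sum>y\<in>N. \<Sum>x\<in>R. f (Nd x, Nd y))" by (rule sum.swap)
    also have "\<dots> \<le> sum I N"
      unfolding I_def using R W pos by (intro sum_mono sum_mono2) auto
    finally have RI: "sum inf R \<le> sum I N" .
    have RN: "R \<subseteq> N" by (auto simp: N_def)
    have "(\<Sum>x\<in>N. f (Src, Nd x)) = sum inf N - sum I N" by (simp add: inf sum.distrib)
    also have "\<dots> \<le> sum inf N - sum inf R" using RI by simp
    also have "\<dots> = sum inf (N - R)" using fin RN by (simp add: sum_diff)
    also have "\<dots> \<le> (\<Sum>x\<in>N - R. 1)" using inf1 NW by (intro sum_mono) auto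
    also have "\<dots> = real (card N) - real (card R)"
      using fin RN by (simp add: card_Diff_subset of_nat_diff card_mono)
    finally have N: "(\<Sum>x\<in>N. f (Src, Nd x)) \<le> real (card N) - real (card R)" .
    have "flow_value W f = (\<Sum>s\<in>S \<inter> N. f (Src, Nd s)) + (\<Sum>s\<in>S - N. f (Src, Nd s))"
      unfolding flow_value_eq[OF W S f] using fin
      by (subst sum.union_disjoint[symmetric]) (auto intro!: sum.cong)
    also have "(\<Sum>s\<in>S \<inter> N. f (Src, Nd s)) \<le> (\<Sum>x\<in>N. f (Src, Nd x))"
      using fin pos by (intro sum_mono2) auto
    also have "(\<Sum>s\<in>S - N. f (Src, Nd s)) \<le> (\<Sum>s\<in>S - N. 1)" using pos by (intro sum_mono) auto
    finally have "flow_value W f \<le> real (card N) - real (card R) + real (card (S - N))"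
      using N by simp
    moreover have "card N = card (N - S) + card (S \<inter> N)"
      using fin by (subst card_Un_disjoint[symmetric]) (auto intro!: arg_cong[of _ _ card])
    moreover have "card S = card (S - N) + card (S \<inter> N)"
      using fin by (subst card_Un_disjoint[symmetric]) (auto intro!: arg_cong[of _ _ card])
    ultimately show ?thesis using viol[folded N_def] by linarith
  qed
  \<comment> \<open>The zero flow makes the set of values nonempty, as a bound on its supremum
    requires.\<close>
  moreover have "is_flow W E S T (\<lambda>_. 0)" by (simp add: is_flow_def)
  ultimately have "max_flow W E S T \<le> real (card S) - 1"
    unfolding max_flow_def by (intro cSup_least) auto
  then show ?thesis by simp
qed

section \<open>Polynomial functions and linear algebra\<close>

text \<open>Gaussian elimination, one equation per induction step: a pivot row \<open>r0\<close>
  clears column \<open>c\<close> in the other rows, which leaves one unknown and one equation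
  fewer.\<close>

lemma underdetermined_system:
  fixes F :: "'r \<Rightarrow> 'c \<Rightarrow> real"
  assumes "finite N" "finite R" "card N < card R"
  shows "\<exists>b. (\<exists>r\<in>R. b r \<noteq> 0) \<and> (\<forall>c\<in>N. (\<Sum>r\<in>R. b r * F r c) = 0)"
  using assms
proof (induction N arbitrary: R F rule: finite_induct)
  case empty
  then have "R \<noteq> {}" by auto
  then show ?case by (intro exI[of _ "\<lambda>_. 1"]) auto
next
  case (insert c N)
  show ?case
  proof (cases "\<forall>r\<in>R. F r c = 0")
    case True
    have "card N < card R" using insert by simp
    from insert.IH[OF insert.prems(1) this, of F] True show ?thesis by auto
  next
    case False
    then obtain r0 where r0: "r0 \<in> R" "F r0 c \<noteq> 0" by blast
    define R' where "R' = R - {r0}"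
    have R: "R = insert r0 R'" "r0 \<notin> R'" "finite R'" using r0 insert.prems by (auto simp: R'_def)
    have "card N < card R'" using insert R by simp
    from insert.IH[OF R(3) this, of "\<lambda>r d. F r d - F r c / F r0 c * F r0 d"]
    obtain b where b: "\<exists>r\<in>R'. b r \<noteq> 0"
      and eq: "\<And>d. d \<in> N \<Longrightarrow> (\<Sum>r\<in>R'. b r * (F r d - F r c / F r0 c * F r0 d)) = 0" by blast
    \<comment> \<open>The coefficient of \<open>r0\<close> is forced by equation
      \<open>c\<close>.\<close>
    define b' where "b' = b(r0 := - (\<Sum>r\<in>R'. b r * F r c) / F r0 c)"
    have sum: "(\<Sum>r\<in>R. b' r * F r d)
        = - (\<Sum>r\<in>R'. b r * F r c) / F r0 c * F r0 d + (\<Sum>r\<in>R'. b r * F r d)" for d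
    proof -
      have "(\<Sum>r\<in>R'. b' r * F r d) = (\<Sum>r\<in>R'. b r * F r d)"
        using R(2) by (intro sum.cong) (auto simp: b'_def)
      then show ?thesis using R by (simp add: b'_def)
    qed
    have "(\<Sum>r\<in>R. b' r * F r d) = 0" if "d \<in> insert c N" for d
    proof (cases "d = c")
      case True then show ?thesis using r0 by (simp add: sum)
    next
      case False
      then have "d \<in> N" using that by simp
      from eq[OF this] show ?thesis
        by (simp add: sum algebra_simps sum_subtractf sum_distrib_left sum_divide_distrib)
    qed
    moreover have "\<exists>r\<in>R. b' r \<noteq> 0" using b R by (auto simp: b'_def)
    ultimately show ?thesis by blast
  qed
qed

section \<open>Polynomial functions\<close>

lemma polyfun_sum: "finite I \<Longrightarrow> (\<And>i. i \<in> I \<Longrightarrow> polyfun c (f i)) \<Longrightarrow> polyfun c (\<lambda>x. \<Sum>i\<in>I. f i x)"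
  by (induction I rule: finite_induct) (auto intro: polyfun.intros)

lemma polyfun_prod: "finite I \<Longrightarrow> (\<And>i. i \<in> I \<Longrightarrow> polyfun c (f i)) \<Longrightarrow> polyfun c (\<lambda>x. \<Prod>i\<in>I. f i x)"
  by (induction I rule: finite_induct) (auto intro: polyfun.intros)

lemma polyfun_cmult: "polyfun c f \<Longrightarrow> polyfun c (\<lambda>x. a * f x)"
  by (intro pmult pconst)

lemma polyfun_diff: "polyfun c f \<Longrightarrow> polyfun c g \<Longrightarrow> polyfun c (\<lambda>x. f x - g x)"
  using padd[OF _ polyfun_cmult[of c g "-1"], of f] by simp

lemma polyfun_det:
  assumes "\<And>i j. i < m \<Longrightarrow> j < m \<Longrightarrow> polyfun c (\<lambda>x. F x i j)"
  shows "polyfun c (\<lambda>x. det (mat m m (\<lambda>(i,j). F x i j)))"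
proof -
  have "det (mat m m (\<lambda>(i,j). F x i j))
      = (\<Sum>p\<in>{p. p permutes {0..<m}}. signof p * (\<Prod>i=0..<m. F x i (p i)))" for x
    by (subst det_def'[of _ m], simp) (intro sum.cong refl arg_cong2[of _ _ _ _ "(*)"] prod.cong,
      auto simp: permutes_in_image)
  moreover have "polyfun c (\<lambda>x. \<Sum>p\<in>{p. p permutes {0..<m}}. signof p * (\<Prod>i=0..<m. F x i (p i)))"
    by (intro polyfun_sum polyfun_cmult polyfun_prod assms) (auto simp: finite_permutations permutes_in_image)
  ultimately show ?thesis by presburger
qed

text \<open>Restricts a polynomial to a curve with polynomial coordinates, which reduces
  nonvanishing to a question in one variable.\<close>

lemma polyfun_compose:
  assumes "polyfun c f" and "\<And>i. polyfun d (\<lambda>t. c (\<gamma> t) i)"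
  shows "polyfun d (\<lambda>t. f (\<gamma> t))"
  using assms(1) by induction (auto intro: polyfun.intros assms(2))

lemma polyfun_univariate:
  assumes "polyfun (\<lambda>t (_::unit). t) f"
  shows "\<exists>p. f = poly p"
  using assms
proof induction
  case (pconst a)
  show ?case by (intro exI[of _ "[:a:]"]) auto
next
  case (pvar i)
  show ?case by (intro exI[of _ "[:0,1:]"]) auto
next
  case (padd p q)
  then obtain p' q' where "p = poly p'" "q = poly q'" by blast
  then show ?case by (intro exI[of _ "p' + q'"]) auto
next
  case (pmult p q)
  then obtain p' q' where "p = poly p'" "q = poly q'" by blast
  then show ?case by (intro exI[of _ "p' * q'"]) auto
qed

lemma polyfun_univariate_finite_zeros:
  assumes "polyfun (\<lambda>t (_::unit). t) f" "f a \<noteq> 0"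
  shows "finite {t. f t = 0}"
proof -
  obtain p where p: "f = poly p" using polyfun_univariate[OF assms(1)] by blast
  then have "p \<noteq> 0" using assms(2) by auto
  then show ?thesis unfolding p by (rule poly_roots_finite)
qed

text \<open>The entries are signed minors, so unlike those of the inverse they need no
  division.\<close>

lemma polyfun_adj_mat:
  assumes "\<And>x. A x \<in> carrier_mat n n" "\<And>i j. i < n \<Longrightarrow> j < n \<Longrightarrow> polyfun c (\<lambda>x. A x $$ (i,j))"
    and "i < n" "j < n"
  shows "polyfun c (\<lambda>x. adj_mat (A x) $$ (i,j))"
proof -
  have [simp]: "dim_row (A x) = n" "dim_col (A x) = n" for x using assms(1)[of x] by auto
  have eq: "adj_mat (A x) $$ (i,j) = (-1)^(j+i) * det (mat (n-1) (n-1)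
     (\<lambda>(i',j'). A x $$ (if i' < j then i' else Suc i', if j' < i then j' else Suc j')))" for x
    using assms(3,4) by (simp add: adj_mat_def cofactor_def mat_delete_def)
  show ?thesis unfolding eq
    by (intro polyfun_cmult polyfun_det assms(2)) auto
qed

lemma polyfun_det_mat:
  assumes "\<And>x. A x \<in> carrier_mat n n" "\<And>i j. i < n \<Longrightarrow> j < n \<Longrightarrow> polyfun c (\<lambda>x. A x $$ (i,j))"
  shows "polyfun c (\<lambda>x. det (A x))"
proof -
  have "A x = mat n n (\<lambda>(i,j). A x $$ (i,j))" for x using assms(1)[of x] by auto
  then show ?thesis using polyfun_det[of n c "\<lambda>x i j. A x $$ (i,j)"] assms(2) by simp
qed

lemma polyfun_subdet:
  assumes "\<And>i j. i \<in> set rs \<Longrightarrow> j \<in> set cs \<Longrightarrow> polyfun c (\<lambda>x. M x $$ (i,j))"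
    and "length rs = length cs"
  shows "polyfun c (\<lambda>x. subdet (M x) rs cs)"
  unfolding subdet_def assms(2) using assms by (intro polyfun_det) auto

text \<open>\<open>polyfun\<close> admits coordinates at all index pairs, also those outside the
  matrix. Such an entry is a lookup beyond the end of a list, which depends on the dimensions and
  the index but not on the contents.\<close>

lemma mat_index_out_of_bounds:
  assumes "A \<in> carrier_mat n m" "B \<in> carrier_mat n m" "\<not> (i < n \<and> j < m)"
  shows "A $$ (i,j) = B $$ (i,j)"
proof -
  have nth_ge: "\<And>i xs. \<not> i < length xs \<Longrightarrow> xs ! i = [] ! (i - length xs)"
    by (metis append_Nil2 nth_append)
  have "undef_mat n m f (i,j) = undef_mat n m g (i,j)" for f g :: "nat \<times> nat \<Rightarrow> 'a"
    using assms(3) by (cases "i < n") (auto simp: undef_mat_def nth_ge[of i] nth_ge[of j])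
  then show ?thesis using assms unfolding carrier_mat_def
    by transfer (auto simp: mk_mat_def)
qed

text \<open>Three finite zero sets cannot cover the unit interval. Its bounds keep convex
  combinations positive definite and, in another use, make \<open>t\<close> a positive
  perturbation.\<close>

lemma polyfun_univariate_common_nonzero:
  assumes "polyfun (\<lambda>t (_::unit). t) f" "f a \<noteq> 0"
    and "polyfun (\<lambda>t (_::unit). t) g" "g b \<noteq> 0"
    and "polyfun (\<lambda>t (_::unit). t) h" "h c \<noteq> 0"
  shows "\<exists>t. 0 < t \<and> t < 1 \<and> f t \<noteq> 0 \<and> g t \<noteq> 0 \<and> h t \<noteq> 0"
proof (rule ccontr)
  assume "\<not> ?thesis"
  then have "{0<..<1} \<subseteq> {t. f t = 0} \<union> {t. g t = 0} \<union> {t. h t = 0}" by auto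
  moreover have "finite ({t. f t = 0} \<union> {t. g t = 0} \<union> {t. h t = 0})"
    using assms polyfun_univariate_finite_zeros by blast
  ultimately have "finite {0<..<1::real}" by (rule finite_subset)
  then show False using infinite_Ioo[of 0 "1::real"] by simp
qed

section \<open>Null vectors, inverses and adjugates\<close>

lemma det_mat_eq_0_iff:
  fixes F :: "nat \<Rightarrow> nat \<Rightarrow> 'a :: field"
  shows "det (mat k k (\<lambda>(i,j). F i j)) = 0 \<longleftrightarrow>
    (\<exists>a. (\<exists>i<k. a i \<noteq> 0) \<and> (\<forall>j<k. (\<Sum>i<k. a i * F i j) = 0))" (is "?L = ?R")
proof -
  let ?A = "mat k k (\<lambda>(i,j). F i j)"
  have "?L \<longleftrightarrow> det ?A\<^sup>T = 0" by (simp add: det_transpose[of _ k])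
  also have "\<dots> \<longleftrightarrow> (\<exists>v. v \<in> carrier_vec k \<and> v \<noteq> 0\<^sub>v k \<and> ?A\<^sup>T *\<^sub>v v = 0\<^sub>v k)"
    by (rule det_0_iff_vec_prod_zero_field) simp
  also have "\<dots> \<longleftrightarrow> ?R"
  proof
    assume "\<exists>v. v \<in> carrier_vec k \<and> v \<noteq> 0\<^sub>v k \<and> ?A\<^sup>T *\<^sub>v v = 0\<^sub>v k"
    then obtain v where v: "v \<in> carrier_vec k" "v \<noteq> 0\<^sub>v k" "?A\<^sup>T *\<^sub>v v = 0\<^sub>v k" by blast
    have "\<exists>i<k. v $ i \<noteq> 0" using v(1,2) by (auto simp: vec_eq_iff)
    moreover have "(\<Sum>i<k. v $ i * F i j) = 0" if "j < k" for j
      using arg_cong[OF v(3), of "\<lambda>w. w $ j"] v(1) that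
      by (simp add: scalar_prod_def lessThan_atLeast0 mult.commute)
    ultimately show ?R by blast
  next
    assume ?R
    then obtain a where a: "\<exists>i<k. a i \<noteq> 0" "\<And>j. j < k \<Longrightarrow> (\<Sum>i<k. a i * F i j) = 0" by blast
    have "vec k a \<noteq> 0\<^sub>v k" using a(1) by (auto simp: vec_eq_iff)
    moreover have "?A\<^sup>T *\<^sub>v vec k a = 0\<^sub>v k"
      using a(2) by (intro eq_vecI) (auto simp: scalar_prod_def lessThan_atLeast0 mult.commute)
    ultimately show "\<exists>v. v \<in> carrier_vec k \<and> v \<noteq> 0\<^sub>v k \<and> ?A\<^sup>T *\<^sub>v v = 0\<^sub>v k"
      by (intro exI[of _ "vec k a"]) auto
  qed
  finally show ?thesis .
qed

lemma mat_inv: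
  fixes A :: "real mat"
  assumes A: "A \<in> carrier_mat n n" and inv: "invertible_mat A"
  shows "mat_inv A \<in> carrier_mat n n" "A * mat_inv A = 1\<^sub>m n" "mat_inv A * A = 1\<^sub>m n"
proof -
  obtain B where B: "inverts_mat A B" "inverts_mat B A" using inv by (auto simp: invertible_mat_def)
  have AB: "A * B = 1\<^sub>m n" and BA: "B * A = 1\<^sub>m (dim_row B)"
    using A B by (auto simp: inverts_mat_def)
  \<comment> \<open>An inverse obtained from \<open>invertible_mat\<close> comes without dimensions;
    they are read off from the two products.\<close>
  have "B \<in> carrier_mat n n"
    using arg_cong[OF AB, of dim_col] arg_cong[OF BA, of dim_col] A by auto
  then have "A \<in> Units (ring_mat TYPE(real) n n)"
    using A AB BA by (auto simp: Units_def ring_mat_def intro!: bexI[of _ B])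
  then obtain C where "mat_inverse A = Some C"
    using mat_inverse(1)[OF A, of n] by (cases "mat_inverse A") auto
  with mat_inverse(2)[OF A this]
  show "mat_inv A \<in> carrier_mat n n" "A * mat_inv A = 1\<^sub>m n" "mat_inv A * A = 1\<^sub>m n"
    by (auto simp: mat_inv_def)
qed

lemma invertible_mat_iff_det:
  fixes A :: "real mat"
  assumes A: "A \<in> carrier_mat n n"
  shows "invertible_mat A \<longleftrightarrow> det A \<noteq> 0"
proof
  assume "invertible_mat A"
  then have "det A * det (mat_inv A) = 1"
    using mat_inv[OF A] A by (metis det_mult det_one)
  then show "det A \<noteq> 0" by auto
next
  assume d: "det A \<noteq> 0"
  let ?B = "inverse (det A) \<cdot>\<^sub>m adj_mat A"
  have "inverse (det A) \<cdot>\<^sub>m (det A \<cdot>\<^sub>m 1\<^sub>m n) = 1\<^sub>m n"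
    using d by (intro eq_matI) auto
  then have "A * ?B = 1\<^sub>m n" "?B * A = 1\<^sub>m n"
    using A adj_mat[OF A]
    by (simp_all add: mult_smult_distrib[of _ n n _ n] mult_smult_assoc_mat[of _ n n _ n])
  then show "invertible_mat A"
    using A adj_mat(1)[OF A] by (auto simp: invertible_mat_def inverts_mat_def intro!: exI[of _ ?B])
qed

lemma adj_mat_eq_mat_inv:
  fixes A :: "real mat"
  assumes A: "A \<in> carrier_mat n n" and "invertible_mat A"
  shows "adj_mat A = det A \<cdot>\<^sub>m mat_inv A"
proof -
  note inv = mat_inv[OF assms]
  have "adj_mat A = (mat_inv A * A) * adj_mat A" using inv adj_mat(1)[OF A] by simp
  also have "\<dots> = mat_inv A * (A * adj_mat A)"
    using inv A adj_mat(1)[OF A] by (intro assoc_mult_mat) auto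
  also have "\<dots> = det A \<cdot>\<^sub>m mat_inv A"
    using inv by (simp add: adj_mat(2)[OF A] mult_smult_distrib[of _ n n _ n])
  finally show ?thesis .
qed

section \<open>Irreducibility of the parameter space\<close>

lemma quadratic_form_sum:
  assumes "x \<in> carrier_vec n" "M \<in> carrier_mat n n"
  shows "x \<bullet> (M *\<^sub>v x) = (\<Sum>i<n. \<Sum>j<n. x $ i * M $$ (i,j) * x $ j)"
  using assms by (auto simp: scalar_prod_def lessThan_atLeast0 sum_distrib_left mult.assoc intro!: sum.cong)

definition segment_mat :: "nat \<Rightarrow> real mat \<Rightarrow> real mat \<Rightarrow> real \<Rightarrow> real mat" where
  "segment_mat n A B t = mat n n (\<lambda>(i,j). (1 - t) * A $$ (i,j) + t * B $$ (i,j))"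

lemma segment_mat_carrier [simp]: "segment_mat n A B t \<in> carrier_mat n n"
  by (simp add: segment_mat_def)

lemma segment_mat_dim [simp]:
  "dim_row (segment_mat n A B t) = n" "dim_col (segment_mat n A B t) = n"
  by (simp_all add: segment_mat_def)

lemma segment_mat_0: "A \<in> carrier_mat n n \<Longrightarrow> segment_mat n A B 0 = A"
  by (auto simp: segment_mat_def)

lemma segment_mat_1: "B \<in> carrier_mat n n \<Longrightarrow> segment_mat n A B 1 = B"
  by (auto simp: segment_mat_def)

lemma polyfun_segment_mat: "polyfun (\<lambda>t (_::unit). t) (\<lambda>t. segment_mat n A B t $$ (i,j))"
proof (cases "i < n \<and> j < n")
  case True
  then show ?thesis
    by (auto simp: segment_mat_def
        intro!: padd pmult polyfun_diff pconst pvar[where c = "\<lambda>t (_::unit). t"])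
next
  case False
  \<comment> \<open>Out of range all n x n matrices agree, so the identity matrix can stand for a
    constant value.\<close>
  have "segment_mat n A B t $$ (i,j) = 1\<^sub>m n $$ (i,j)" for t
    by (rule mat_index_out_of_bounds[OF _ _ False]) auto
  then show ?thesis by (simp add: pconst)
qed

lemma polyfun_det_one_minus_segment:
  "polyfun (\<lambda>t (_::unit). t) (\<lambda>t. det (1\<^sub>m n - segment_mat n A B t))"
proof (rule polyfun_det_mat)
  fix i j assume "i < n" "j < n"
  then show "polyfun (\<lambda>t (_::unit). t) (\<lambda>t. (1\<^sub>m n - segment_mat n A B t) $$ (i,j))"
    by (simp add: polyfun_diff pconst polyfun_segment_mat)
qed (auto intro!: minus_carrier_mat)

lemma pos_def_segment_mat:
  assumes A: "pos_def_mat n A" and B: "pos_def_mat n B" and t: "0 \<le> t" "t \<le> 1"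
  shows "pos_def_mat n (segment_mat n A B t)"
proof -
  have C: "A \<in> carrier_mat n n" "B \<in> carrier_mat n n" using A B by (auto simp: pos_def_mat_def)
  have sym: "M $$ (j,i) = M $$ (i,j)" if "pos_def_mat n M" "i < n" "j < n" for M i j
    using that by (metis pos_def_mat_def carrier_matD index_transpose_mat(1))
  have "(segment_mat n A B t)\<^sup>T = segment_mat n A B t"
    using sym[OF A] sym[OF B] by (intro eq_matI) (auto simp: segment_mat_def)
  moreover have "x \<bullet> (segment_mat n A B t *\<^sub>v x) > 0" if x: "x \<in> carrier_vec n" "x \<noteq> 0\<^sub>v n" for x
  proof -
    have "x \<bullet> (segment_mat n A B t *\<^sub>v x) = (1 - t) * (x \<bullet> (A *\<^sub>v x)) + t * (x \<bullet> (B *\<^sub>v x))"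
      unfolding quadratic_form_sum[OF x(1) C(1)] quadratic_form_sum[OF x(1) C(2)]
        quadratic_form_sum[OF x(1) segment_mat_carrier]
      by (auto simp: segment_mat_def sum_distrib_left sum.distrib[symmetric] algebra_simps intro!: sum.cong)
    moreover have pos: "x \<bullet> (A *\<^sub>v x) > 0" "x \<bullet> (B *\<^sub>v x) > 0"
      using A B x by (auto simp: pos_def_mat_def)
    moreover have "(1 - t) * (x \<bullet> (A *\<^sub>v x)) + t * (x \<bullet> (B *\<^sub>v x)) > 0"
    proof (cases "t = 0")
      case False
      then show ?thesis using pos t by (intro add_nonneg_pos) auto
    qed (use pos in auto)
    ultimately show ?thesis by simp
  qed
  ultimately show ?thesis by (auto simp: pos_def_mat_def)
qed

lemma RD_reg_segment:
  assumes "A \<in> RD_reg n D" "B \<in> RD_reg n D" "det (1\<^sub>m n - segment_mat n A B t) \<noteq> 0"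
  shows "segment_mat n A B t \<in> RD_reg n D"
proof -
  have "invertible_mat (1\<^sub>m n - segment_mat n A B t)"
    using assms(3) invertible_mat_iff_det[of "1\<^sub>m n - segment_mat n A B t" n]
    by (simp add: minus_carrier_mat)
  then show ?thesis using assms(1,2) by (auto simp: RD_reg_def) (simp add: segment_mat_def)
qed

text \<open>Joins the two points by a segment. Positive definiteness survives on it by convexity;
  invertibility of \<open>I - \<Lambda>\<close> may fail, but only at the finitely many zeros of a
  determinant that is nonzero at \<open>t = 0\<close>. Some interior point avoids these and the
  zeros of both polynomials, so two proper algebraic subsets never cover
  \<open>Theta\<close>.\<close>

lemma Theta_irreducible:
  assumes f: "polyfun param_coords f" "\<theta>0 \<in> Theta n D B" "f \<theta>0 \<noteq> 0"
    and g: "polyfun param_coords g" "\<theta>1 \<in> Theta n D B" "g \<theta>1 \<noteq> 0"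
  shows "\<exists>\<theta>\<in>Theta n D B. f \<theta> * g \<theta> \<noteq> 0"
proof -
  define L where "L = segment_mat n (fst \<theta>0) (fst \<theta>1)"
  define Om where "Om = segment_mat n (snd \<theta>0) (snd \<theta>1)"
  define \<gamma> where "\<gamma> = (\<lambda>t. (L t, Om t))"
  have RD: "fst \<theta>0 \<in> RD_reg n D" "fst \<theta>1 \<in> RD_reg n D"
    and PD: "snd \<theta>0 \<in> PD_B n B" "snd \<theta>1 \<in> PD_B n B" using f g by (auto simp: Theta_def)
  have C: "fst \<theta>0 \<in> carrier_mat n n" "fst \<theta>1 \<in> carrier_mat n n"
    "snd \<theta>0 \<in> carrier_mat n n" "snd \<theta>1 \<in> carrier_mat n n"
    using RD PD by (auto simp: RD_reg_def PD_B_def pos_def_mat_def)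
  have pc: "polyfun (\<lambda>t (_::unit). t) (\<lambda>t. param_coords (\<gamma> t) i)" for i
  proof (cases i)
    case (fields b j k)
    then show ?thesis
      by (cases b) (simp_all add: param_coords_def \<gamma>_def L_def Om_def polyfun_segment_mat)
  qed
  have \<gamma>01: "\<gamma> 0 = \<theta>0" "\<gamma> 1 = \<theta>1"
    using C by (auto simp: \<gamma>_def L_def Om_def segment_mat_0 segment_mat_1)
  obtain t where t: "0 < t" "t < 1" "f (\<gamma> t) \<noteq> 0" "g (\<gamma> t) \<noteq> 0" "det (1\<^sub>m n - L t) \<noteq> 0"
  proof -
    have "det (1\<^sub>m n - L 0) \<noteq> 0"
      using RD(1) C(1) invertible_mat_iff_det[of "1\<^sub>m n - fst \<theta>0" n]
      by (simp add: L_def segment_mat_0 RD_reg_def minus_carrier_mat)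
    then show ?thesis
      using that polyfun_univariate_common_nonzero[OF polyfun_compose[OF f(1) pc], of 0
          "\<lambda>t. g (\<gamma> t)" 1 "\<lambda>t. det (1\<^sub>m n - L t)" 0] polyfun_compose[OF g(1) pc] f(3) g(3) \<gamma>01
        polyfun_det_one_minus_segment[of n "fst \<theta>0" "fst \<theta>1"] by (auto simp: L_def)
  qed
  have "L t \<in> RD_reg n D" using RD_reg_segment[OF RD] t(5) by (simp add: L_def)
  moreover have "Om t \<in> PD_B n B"
    using PD pos_def_segment_mat[of n "snd \<theta>0" "snd \<theta>1" t] t(1,2)
    by (auto simp: PD_B_def Om_def) (simp add: segment_mat_def)
  ultimately have "\<gamma> t \<in> Theta n D B" by (simp add: \<gamma>_def Theta_def)
  then show ?thesis using t by auto
qed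

section \<open>Minors that do not vanish identically\<close>

lemma one_minus_mult_vec_index:
  fixes L :: "real mat"
  assumes "L \<in> carrier_mat n n" "y \<in> carrier_vec n" "r < n"
  shows "((1\<^sub>m n - L) *\<^sub>v y) $ r = y $ r - (\<Sum>i<n. L $$ (r,i) * y $ i)"
proof -
  have "((1\<^sub>m n - L) *\<^sub>v y) $ r = (\<Sum>i<n. ((if r = i then 1 else 0) - L $$ (r,i)) * y $ i)"
    using assms by (auto simp: scalar_prod_def lessThan_atLeast0 intro!: sum.cong)
  also have "\<dots> = (\<Sum>i<n. (if r = i then y $ i else 0) - L $$ (r,i) * y $ i)"
    by (intro sum.cong) (auto simp: algebra_simps)
  finally show ?thesis using assms(3) by (simp add: sum_subtractf)
qed

text \<open>The weight 2 on the edges of the matching makes both relevant homogeneous systems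
  contradict the choice of an entry of extremal absolute value.\<close>

lemma adj_minor_of_matching:
  assumes D: "D \<subseteq> {0..<n} \<times> {0..<n}"
    and xs: "distinct xs" "set xs \<subseteq> {0..<n}" and ss: "distinct ss" "set ss \<subseteq> {0..<n}"
    and len: "length ss = length xs"
    and bij: "bij_betw \<tau> ({0..<n} - set xs) ({0..<n} - set ss)"
    and edge: "\<And>i. i \<in> {0..<n} - set xs \<Longrightarrow> \<tau> i = i \<or> (\<tau> i, i) \<in> D"
  shows "\<exists>L\<in>RD_reg n D. subdet (adj_mat (1\<^sub>m n - L))\<^sup>T ss xs \<noteq> 0"
proof -
  define P where "P = {0..<n} - set xs"
  \<comment> \<open>Twice a partial permutation matrix: at most one entry per column, and at most
    one per row since \<open>\<tau>\<close> is injective. Hence each coordinate of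
    \<open>A *\<^sub>v y\<close> involves at most two of \<open>y\<close>.\<close>
  define L :: "real mat" where "L = mat n n (\<lambda>(r,i). if i \<in> P \<and> \<tau> i = r \<and> r \<noteq> i then 2 else 0)"
  define A where "A = 1\<^sub>m n - L"
  have L: "L \<in> carrier_mat n n" and A: "A \<in> carrier_mat n n"
    by (auto simp: L_def A_def intro: minus_carrier_mat)
  have inj: "i = j" if "i \<in> P" "j \<in> P" "\<tau> i = \<tau> j" for i j
    using bij that by (auto simp: bij_betw_def inj_on_def P_def)
  have \<tau>: "\<tau> i < n \<and> \<tau> i \<notin> set ss" if "i \<in> P" for i
    using bij that by (auto simp: bij_betw_def P_def)
  have row1: "(A *\<^sub>v y) $ \<tau> i = y $ \<tau> i - 2 * y $ i"
    if "y \<in> carrier_vec n" "i \<in> P" "\<tau> i \<noteq> i" for y i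
  proof -
    have "L $$ (\<tau> i, j) * y $ j = (if j = i then 2 * y $ i else 0)" if "j < n" for j
      using \<open>i \<in> P\<close> \<open>\<tau> i \<noteq> i\<close> \<tau>[of i] inj[of j i] that by (auto simp: L_def)
    then have "(\<Sum>j<n. L $$ (\<tau> i, j) * y $ j) = (\<Sum>j<n. if j = i then 2 * y $ i else 0)"
      by (intro sum.cong) auto
    also have "\<dots> = 2 * y $ i" using \<open>i \<in> P\<close> by (simp add: P_def)
    finally show ?thesis
      unfolding A_def using one_minus_mult_vec_index[OF L that(1), of "\<tau> i"] \<tau>[OF that(2)] by simp
  qed
  have row2: "(A *\<^sub>v y) $ r = y $ r"
    if "y \<in> carrier_vec n" "r < n" "\<And>i. i \<in> P \<Longrightarrow> \<tau> i = r \<Longrightarrow> i = r" for y r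
  proof -
    have "L $$ (r, j) = 0" if "j < n" for j
      using \<open>r < n\<close> that \<open>\<And>i. i \<in> P \<Longrightarrow> \<tau> i = r \<Longrightarrow> i = r\<close>[of j] by (auto simp: L_def)
    then have "(\<Sum>j<n. L $$ (r, j) * y $ j) = 0" by simp
    then show ?thesis unfolding A_def using one_minus_mult_vec_index[OF L that(1,2)] by simp
  qed
  have detA: "det A \<noteq> 0"
  proof
    assume "det A = 0"
    then obtain y where y: "y \<in> carrier_vec n" "y \<noteq> 0\<^sub>v n" "A *\<^sub>v y = 0\<^sub>v n"
      using det_0_iff_vec_prod_zero_field[OF A] by blast
    \<comment> \<open>At a nonzero entry of least absolute value the equation reads
      \<open>y $ r = 2 * y $ i\<close>, with \<open>y $ i\<close> smaller and nonzero, or else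
      \<open>y $ r = 0\<close>. Both are absurd.\<close>
    define Z where "Z = {r. r < n \<and> y $ r \<noteq> 0}"
    have Z: "finite Z" "Z \<noteq> {}" using y(1,2) by (auto simp: Z_def vec_eq_iff)
    have "Min ((\<lambda>r. \<bar>y $ r\<bar>) ` Z) \<in> (\<lambda>r. \<bar>y $ r\<bar>) ` Z" using Z by (intro Min_in) auto
    then obtain r where r: "r \<in> Z" "\<bar>y $ r\<bar> = Min ((\<lambda>r. \<bar>y $ r\<bar>) ` Z)" by force
    have min: "\<bar>y $ r\<bar> \<le> \<bar>y $ i\<bar>" if "i \<in> Z" for i unfolding r(2) using Z that by simp
    have yr: "r < n" "y $ r \<noteq> 0" using r(1) by (auto simp: Z_def)
    show False
    proof (cases "\<exists>i\<in>P. \<tau> i = r \<and> i \<noteq> r")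
      case True
      then obtain i where i: "i \<in> P" "\<tau> i = r" "i \<noteq> r" by blast
      then have "y $ r = 2 * y $ i" using row1[OF y(1) i(1)] y(3) yr by simp
      moreover from this have "i \<in> Z" using yr i(1) by (auto simp: Z_def P_def)
      ultimately show False using min[of i] yr by auto
    next
      case False
      then show False using row2[OF y(1) yr(1)] y(3) yr by auto
    qed
  qed
  have "L \<in> RD_reg n D"
    using edge L invertible_mat_iff_det[OF A] detA by (auto simp: RD_reg_def A_def L_def P_def)
  moreover have "subdet (adj_mat A)\<^sup>T ss xs \<noteq> 0"
  proof
    assume "subdet (adj_mat A)\<^sup>T ss xs = 0"
    define k where "k = length xs"
    have adj: "adj_mat A \<in> carrier_mat n n" by (rule adj_mat(1)[OF A])
    have lt: "ss ! i < n" "xs ! i < n" if "i < k" for i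
      using that ss(2) xs(2) len unfolding k_def by (metis atLeastLessThan_iff nth_mem subsetD)+
    from \<open>subdet _ _ _ = 0\<close> obtain a where a: "\<exists>i<k. a i \<noteq> 0"
      "\<And>j. j < k \<Longrightarrow> (\<Sum>i<k. a i * (adj_mat A)\<^sup>T $$ (ss ! i, xs ! j)) = 0"
      unfolding subdet_def len det_mat_eq_0_iff k_def by blast
    \<comment> \<open>The left null vector \<open>a\<close> of the minor, spread over the positions
      \<open>ss\<close>. Then \<open>y = adj_mat A *\<^sub>v c\<close> vanishes on
      \<open>xs\<close>, while \<open>A *\<^sub>v y\<close> is a multiple of \<open>c\<close> and so
      vanishes off \<open>ss\<close>.\<close>
    define c where "c = vec n (\<lambda>r. \<Sum>i<k. if r = ss ! i then a i else 0)"
    have c: "c \<in> carrier_vec n" by (simp add: c_def)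
    define y where "y = adj_mat A *\<^sub>v c"
    have y: "y \<in> carrier_vec n" using mult_mat_vec_carrier[OF adj c] by (simp add: y_def)
    have "A *\<^sub>v y = (A * adj_mat A) *\<^sub>v c"
      unfolding y_def using A adj c by (simp add: assoc_mult_mat_vec)
    also have "\<dots> = det A \<cdot>\<^sub>v c"
      unfolding adj_mat(2)[OF A] using c one_mult_mat_vec[OF c]
    by (intro eq_vecI) (auto simp: scalar_prod_def mult.assoc sum_distrib_left[symmetric] if_distrib[of "\<lambda>z. z * _"] cong: if_cong)
    finally have Ay: "A *\<^sub>v y = det A \<cdot>\<^sub>v c" .
    have yx: "y $ x = 0" if "x \<in> set xs" for x
    proof -
      from that obtain j where j: "j < k" "x = xs ! j" by (auto simp: in_set_conv_nth k_def)
      have "y $ x = (\<Sum>r<n. adj_mat A $$ (x,r) * c $ r)"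
        using adj c lt[OF j(1)] j(2) by (simp add: y_def scalar_prod_def lessThan_atLeast0)
      also have "\<dots> = (\<Sum>r<n. \<Sum>i<k. if r = ss ! i then adj_mat A $$ (x, ss ! i) * a i else 0)"
        by (auto simp: c_def sum_distrib_left intro!: sum.cong)
      also have "\<dots> = (\<Sum>i<k. \<Sum>r<n. if r = ss ! i then adj_mat A $$ (x, ss ! i) * a i else 0)"
        by (rule sum.swap)
      also have "\<dots> = (\<Sum>i<k. a i * (adj_mat A)\<^sup>T $$ (ss ! i, xs ! j))"
        using adj lt j by (intro sum.cong) auto
      finally show ?thesis using a(2)[OF j(1)] by simp
    qed
    have Ay0: "(A *\<^sub>v y) $ \<tau> i = 0" if "i \<in> P" for i
    proof -
      have "c $ \<tau> i = 0"
        using \<tau>[OF that] len by (auto simp: c_def k_def intro!: sum.neutral)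
      then show ?thesis using \<tau>[OF that] c by (simp add: Ay)
    qed
    \<comment> \<open>A nonzero entry of largest absolute value has its index \<open>r\<close> in
      \<open>P\<close>, and row \<open>\<tau> r\<close> gives
      \<open>y $ \<tau> r = 2 * y $ r\<close>, which is larger, unless \<open>\<tau> r = r\<close>,
      where the row says that the entry is zero.\<close>
    have "y = 0\<^sub>v n"
    proof (rule ccontr)
      assume "y \<noteq> 0\<^sub>v n"
      then obtain r0 where r0: "r0 < n" "y $ r0 \<noteq> 0" using y by (auto simp: vec_eq_iff)
      then have "Max ((\<lambda>r. \<bar>y $ r\<bar>) ` {..<n}) \<in> (\<lambda>r. \<bar>y $ r\<bar>) ` {..<n}" by (intro Max_in) auto
      then obtain r where r: "r < n" "\<bar>y $ r\<bar> = Max ((\<lambda>r. \<bar>y $ r\<bar>) ` {..<n})" by force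
      have max: "\<bar>y $ i\<bar> \<le> \<bar>y $ r\<bar>" if "i < n" for i unfolding r(2) using that by simp
      have "y $ r \<noteq> 0" using max[OF r0(1)] r0(2) by auto
      then have rP: "r \<in> P" using yx r(1) by (auto simp: P_def)
      show False
      proof (cases "\<tau> r = r")
        case True
        then have "(A *\<^sub>v y) $ r = y $ r" using inj rP by (intro row2[OF y r(1)]) auto
        then show False using Ay0[OF rP] True \<open>y $ r \<noteq> 0\<close> by simp
      next
        case False
        then show False
          using row1[OF y rP] Ay0[OF rP] max[of "\<tau> r"] \<tau>[OF rP] \<open>y $ r \<noteq> 0\<close> by auto
      qed
    qed
    have c0: "c $ r = 0" if "r < n" for r
    proof -
      have "det A * c $ r = (A *\<^sub>v y) $ r" using that c by (simp add: Ay)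
      also have "\<dots> = 0" using that A by (simp add: \<open>y = 0\<^sub>v n\<close> scalar_prod_def)
      finally show ?thesis using detA by simp
    qed
    from a(1) obtain i where i: "i < k" "a i \<noteq> 0" by blast
    have "c $ (ss ! i) = (\<Sum>j<k. if j = i then a j else 0)"
      using ss(1) i(1) lt len unfolding c_def k_def
      by (auto simp: nth_eq_iff_index_eq intro!: sum.cong)
    then show False using i c0[of "ss ! i"] lt by simp
  qed
  ultimately show ?thesis unfolding A_def by blast
qed

lemma polyfun_mat_mult:
  assumes "\<And>x. A x \<in> carrier_mat n m" "\<And>x. B x \<in> carrier_mat m p"
    and "\<And>i j. i < n \<Longrightarrow> j < m \<Longrightarrow> polyfun c (\<lambda>x. A x $$ (i,j))"
    and "\<And>i j. i < m \<Longrightarrow> j < p \<Longrightarrow> polyfun c (\<lambda>x. B x $$ (i,j))"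
    and "i < n" "j < p"
  shows "polyfun c (\<lambda>x. (A x * B x) $$ (i,j))"
proof -
  have "(A x * B x) $$ (i,j) = (\<Sum>l<m. A x $$ (i,l) * B x $$ (l,j))" for x
    using assms(1)[of x] assms(2)[of x] assms(5,6)
    by (simp add: scalar_prod_def lessThan_atLeast0)
  moreover have "polyfun c (\<lambda>x. \<Sum>l<m. A x $$ (i,l) * B x $$ (l,j))"
    using assms by (intro polyfun_sum pmult) auto
  ultimately show ?thesis by simp
qed

text \<open>Cauchy-Binet with a single summand, since \<open>U\<close> has only \<open>k\<close>
  columns.\<close>

lemma subdet_mult_transpose:
  assumes U: "U \<in> carrier_mat n k" and rs: "set rs \<subseteq> {0..<n}" "length rs = k"
    and cs: "set cs \<subseteq> {0..<n}" "length cs = k"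
  shows "subdet (U * U\<^sup>T) rs cs = subdet U rs [0..<k] * subdet U cs [0..<k]"
proof -
  define M where "M = (\<lambda>rs. mat k k (\<lambda>(i,j). U $$ (rs ! i, j)))"
  have lt: "rs ! i < n" "cs ! i < n" if "i < k" for i
    using that rs cs by (metis atLeastLessThan_iff nth_mem subsetD)+
  have "mat k k (\<lambda>(i,j). (U * U\<^sup>T) $$ (rs ! i, cs ! j)) = M rs * (M cs)\<^sup>T"
    using U lt by (intro eq_matI) (auto simp: M_def scalar_prod_def intro!: sum.cong)
  then have "subdet (U * U\<^sup>T) rs cs = det (M rs * (M cs)\<^sup>T)" by (simp add: subdet_def rs cs)
  also have "\<dots> = det (M rs) * det (M cs)"
    by (subst det_mult[of _ k]) (auto simp: M_def det_transpose[of _ k])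
  also have "\<dots> = subdet U rs [0..<k] * subdet U cs [0..<k]"
    unfolding M_def subdet_def rs cs
    by (intro arg_cong2[of _ _ _ _ "(*)"] arg_cong[of _ _ det] eq_matI) auto
  finally show ?thesis .
qed

lemma Gflow_edges_cases:
  shows "(Inl i, Inl j) \<in> Gflow_edges n D B \<longleftrightarrow> (j,i) \<in> D"
    and "(Inl i, Inr j) \<in> Gflow_edges n D B \<longleftrightarrow> (i = j \<and> i < n) \<or> (i,j) \<in> B"
    and "(Inr i, Inl j) \<notin> Gflow_edges n D B"
    and "(Inr i, Inr j) \<in> Gflow_edges n D B \<longleftrightarrow> (i,j) \<in> D"
  by (auto simp: Gflow_edges_def)

lemma Gflow_edges_subset:
  "mixed_graph n D B \<Longrightarrow> Gflow_edges n D B \<subseteq> Gflow_verts n \<times> Gflow_verts n"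
  by (auto simp: Gflow_edges_def Gflow_verts_def mixed_graph_def)

text \<open>On \<open>Theta\<close> this is \<open>phiG\<close> times the square of
  \<open>det (I - L)\<close>: its minors are polynomial in the parameters and vanish exactly where
  those of \<open>phiG\<close> do.\<close>

definition adj_cov :: "nat \<Rightarrow> real mat \<Rightarrow> real mat \<Rightarrow> real mat" where
  "adj_cov n L Om = (adj_mat (1\<^sub>m n - L))\<^sup>T * Om * adj_mat (1\<^sub>m n - L)"

text \<open>A Gram matrix is positive semidefinite, and \<open>\<epsilon>\<close> on the diagonal
  makes it definite. Column \<open>a\<close> of \<open>C\<close> lives on \<open>x a\<close> and
  \<open>y a\<close>, so off the diagonal only bidirected pairs can get a nonzero entry.\<close>

lemma gram_plus_diag_PD_B:
  assumes B: "\<And>i j. (i,j) \<in> B \<Longrightarrow> (j,i) \<in> B"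
    and supp: "\<And>a r. a < k \<Longrightarrow> r < n \<Longrightarrow> C $$ (r,a) \<noteq> 0 \<Longrightarrow> r = x a \<or> r = y a"
    and xy: "\<And>a. a < k \<Longrightarrow> x a = y a \<or> (x a, y a) \<in> B"
    and \<epsilon>: "\<epsilon> > 0"
  shows "mat n n (\<lambda>(i,j). (\<Sum>a<k. C $$ (i,a) * C $$ (j,a)) + (if i = j then \<epsilon> else 0)) \<in> PD_B n B"
    (is "?M \<in> _")
proof -
  have "z \<bullet> (?M *\<^sub>v z) > 0" if z: "z \<in> carrier_vec n" "z \<noteq> 0\<^sub>v n" for z
  proof -
    have "z \<bullet> (?M *\<^sub>v z) = (\<Sum>i<n. \<Sum>j<n. z $ i * ?M $$ (i,j) * z $ j)"
      by (rule quadratic_form_sum[OF z(1)]) simp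
    also have "\<dots> = (\<Sum>i<n. \<Sum>j<n. (\<Sum>a<k. (z $ i * C $$ (i,a)) * (z $ j * C $$ (j,a)))
        + (if i = j then \<epsilon> * (z $ i)\<^sup>2 else 0))"
      by (intro sum.cong refl)
        (auto simp: sum_distrib_left sum_distrib_right algebra_simps power2_eq_square)
    also have "\<dots> = (\<Sum>i<n. \<Sum>j<n. \<Sum>a<k. (z $ i * C $$ (i,a)) * (z $ j * C $$ (j,a)))
        + (\<Sum>i<n. \<epsilon> * (z $ i)\<^sup>2)" by (simp add: sum.distrib)
    also have "(\<Sum>i<n. \<Sum>j<n. \<Sum>a<k. (z $ i * C $$ (i,a)) * (z $ j * C $$ (j,a)))
        = (\<Sum>i<n. \<Sum>a<k. \<Sum>j<n. (z $ i * C $$ (i,a)) * (z $ j * C $$ (j,a)))"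
      by (intro sum.cong refl sum.swap)
    also have "\<dots> = (\<Sum>a<k. \<Sum>i<n. \<Sum>j<n. (z $ i * C $$ (i,a)) * (z $ j * C $$ (j,a)))"
      by (rule sum.swap)
    also have "\<dots> = (\<Sum>a<k. (\<Sum>i<n. z $ i * C $$ (i,a))\<^sup>2)"
      by (simp only: power2_eq_square sum_product)
    finally have "z \<bullet> (?M *\<^sub>v z) = (\<Sum>a<k. (\<Sum>i<n. z $ i * C $$ (i,a))\<^sup>2) + (\<Sum>i<n. \<epsilon> * (z $ i)\<^sup>2)" .
    moreover have "(\<Sum>i<n. \<epsilon> * (z $ i)\<^sup>2) > 0"
    proof -
      obtain i where "i < n" "z $ i \<noteq> 0" using z by (auto simp: vec_eq_iff)
      then show ?thesis using \<epsilon> by (intro sum_pos2[of _ i]) auto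
    qed
    moreover have "(\<Sum>a<k. (\<Sum>i<n. z $ i * C $$ (i,a))\<^sup>2) \<ge> 0" by (intro sum_nonneg) auto
    ultimately show ?thesis by linarith
  qed
  moreover have "?M\<^sup>T = ?M" by (intro eq_matI) (auto simp: mult.commute)
  moreover have "(\<Sum>a<k. C $$ (i,a) * C $$ (j,a)) = 0"
    if "i < n" "j < n" "i \<noteq> j" "(i,j) \<notin> B" for i j
  proof (intro sum.neutral ballI)
    fix a assume "a \<in> {..<k}"
    then have "a < k" by simp
    then show "C $$ (i,a) * C $$ (j,a) = 0"
      using supp[OF _ that(1)] supp[OF _ that(2)] xy that B by (metis mult_eq_0_iff)
  qed
  ultimately show ?thesis by (auto simp: PD_B_def pos_def_mat_def)
qed

text \<open>The columns (1 - t) e_x + t e_y of the factor of Omega separate the two halves of the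
  flow: t = 0 leaves only the minor of the unprimed copy, t = 1 only that of the primed copy.\<close>

lemma ex_adj_cov_minor_nonzero:
  assumes G: "mixed_graph n D B"
    and ss: "distinct ss" "set ss \<subseteq> {0..<n}" and ts: "distinct ts" "set ts \<subseteq> {0..<n}"
    and len: "length ss = length ts"
    and bij: "bij_betw \<sigma> (Gflow_verts n - Inr ` set ts) (Gflow_verts n - Inl ` set ss)"
    and edge: "\<And>r. r \<in> Gflow_verts n - Inr ` set ts \<Longrightarrow> \<sigma> r = r \<or> (r, \<sigma> r) \<in> Gflow_edges n D B"
  shows "\<exists>\<theta>\<in>Theta n D B. subdet (adj_cov n (fst \<theta>) (snd \<theta>)) ss ts \<noteq> 0"
proof -
  define V where "V = {0..<n}"
  have D: "D \<subseteq> V \<times> V" and Bsym: "\<And>i j. (i,j) \<in> B \<Longrightarrow> (j,i) \<in> B"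
    using G by (auto simp: mixed_graph_def V_def)
  define W1 where "W1 = Gflow_verts n - Inr ` set ts"
  define W2 where "W2 = Gflow_verts n - Inl ` set ss"
  have memV: "Inl i \<in> W1 \<longleftrightarrow> i \<in> V" "Inr i \<in> W1 \<longleftrightarrow> i \<in> V - set ts"
    "Inl i \<in> W2 \<longleftrightarrow> i \<in> V - set ss" "Inr i \<in> W2 \<longleftrightarrow> i \<in> V" for i
    by (auto simp: W1_def W2_def Gflow_verts_def V_def)
  have \<sigma>W: "\<sigma> r \<in> W2" if "r \<in> W1" for r
    using bij that by (auto simp: bij_betw_def W1_def W2_def)
  have \<sigma>inj: "r = r'" if "r \<in> W1" "r' \<in> W1" "\<sigma> r = \<sigma> r'" for r r'
    using bij that by (auto simp: bij_betw_def inj_on_def W1_def)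
  have \<sigma>surj: "\<exists>r\<in>W1. \<sigma> r = c" if "c \<in> W2" for c
    using bij that unfolding bij_betw_def W1_def W2_def by (metis imageE)
  \<comment> \<open>No edge returns from the primed to the unprimed copy, so \<open>\<sigma>\<close>
    splits into a part inside each copy and the crossings, which start in \<open>X\<close>.\<close>
  have \<sigma>r: "\<exists>j. \<sigma> (Inr i) = Inr j" if "Inr i \<in> W1" for i
    using edge[of "Inr i"] that Gflow_edges_cases(3)[of i _ n D B]
    by (cases "\<sigma> (Inr i)") (auto simp: W1_def)
  define X where "X = {x \<in> V. \<exists>y. \<sigma> (Inl x) = Inr y}"
  define y where "y = (\<lambda>x. projr (\<sigma> (Inl x)))"
  have X\<sigma>: "\<sigma> (Inl x) = Inr (y x)" if "x \<in> X" for x using that by (auto simp: X_def y_def)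
  have XW1: "Inl x \<in> W1" if "x \<in> X" for x using that memV(1)[of x] by (simp add: X_def)
  have yV: "y x \<in> V" if "x \<in> X" for x
    using \<sigma>W[of "Inl x"] X\<sigma>[OF that] that memV by (auto simp: X_def)
  have y_inj: "inj_on y X"
  proof (rule inj_onI)
    fix p q assume pq: "p \<in> X" "q \<in> X" "y p = y q"
    then have "\<sigma> (Inl p) = \<sigma> (Inl q)" by (simp add: X\<sigma>)
    with XW1[OF pq(1)] XW1[OF pq(2)] have "(Inl p :: nat + nat) = Inl q" by (rule \<sigma>inj)
    then show "p = q" by simp
  qed
  define \<tau>1 where "\<tau>1 = (\<lambda>i. projl (\<sigma> (Inl i)))"
  have \<tau>1: "\<sigma> (Inl i) = Inl (\<tau>1 i)" if "i \<in> V - X" for i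
    using that by (cases "\<sigma> (Inl i)") (auto simp: X_def \<tau>1_def)
  have bij1: "bij_betw \<tau>1 (V - X) (V - set ss)"
  proof (rule bij_betw_imageI)
    show "inj_on \<tau>1 (V - X)"
    proof (rule inj_onI)
      fix p q assume pq: "p \<in> V - X" "q \<in> V - X" "\<tau>1 p = \<tau>1 q"
      then have eq: "\<sigma> (Inl p) = \<sigma> (Inl q)" by (simp add: \<tau>1)
      have "Inl p \<in> W1" "Inl q \<in> W1" using pq memV(1) by simp_all
      from this eq have "(Inl p :: nat + nat) = Inl q" by (rule \<sigma>inj)
      then show "p = q" by simp
    qed
    show "\<tau>1 ` (V - X) = V - set ss"
    proof (intro equalityI subsetI)
      fix j assume "j \<in> \<tau>1 ` (V - X)"
      then obtain i where i: "i \<in> V - X" "j = \<tau>1 i" by blast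
      then show "j \<in> V - set ss" using \<sigma>W[of "Inl i"] \<tau>1[OF i(1)] memV by auto
    next
      fix j assume "j \<in> V - set ss"
      then obtain r where r: "r \<in> W1" "\<sigma> r = Inl j" using \<sigma>surj[of "Inl j"] memV by auto
      then obtain i where i: "r = Inl i" using \<sigma>r by (cases r) force+
      then have "i \<in> V - X" using r memV by (auto simp: X_def)
      then show "j \<in> \<tau>1 ` (V - X)" using \<tau>1[of i] r i by auto
    qed
  qed
  define xs where "xs = sorted_list_of_set X"
  have XV: "X \<subseteq> V" "finite X" by (auto simp: X_def V_def)
  have xs: "distinct xs" "set xs = X" using XV by (auto simp: xs_def)
  define k where "k = length ss"
  \<comment> \<open>Comparing complements shows that exactly \<open>k\<close> vertices
    cross.\<close>
  have "card (V - X) = card (V - set ss)" by (rule bij_betw_same_card[OF bij1])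
  then have "card X = card (set ss)"
    using XV ss card_mono[OF _ XV(1)] card_mono[of V "set ss"]
    by (simp add: card_Diff_subset V_def finite_subset)
  then have lenx: "length xs = k"
    using ss xs by (simp add: distinct_card[symmetric] k_def)
  define ys where "ys = map y xs"
  have ys: "distinct ys" "set ys = y ` X" "length ys = k"
    using xs y_inj lenx by (auto simp: ys_def distinct_map)
  have ysV: "set ys \<subseteq> V" using yV ys by auto
  have \<mu>: "bij_betw (\<lambda>i. projr (\<sigma> (Inr i))) (V - set ts) (V - set ys)"
  proof (rule bij_betw_imageI)
    show "inj_on (\<lambda>i. projr (\<sigma> (Inr i))) (V - set ts)"
    proof (rule inj_onI)
      fix p q assume pq: "p \<in> V - set ts" "q \<in> V - set ts" "projr (\<sigma> (Inr p)) = projr (\<sigma> (Inr q))"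
      then have m: "Inr p \<in> W1" "Inr q \<in> W1" using memV by auto
      then have "\<sigma> (Inr p) = \<sigma> (Inr q)" using \<sigma>r[OF m(1)] \<sigma>r[OF m(2)] pq(3) by auto
      with m have "(Inr p :: nat + nat) = Inr q" by (rule \<sigma>inj)
      then show "p = q" by simp
    qed
    show "(\<lambda>i. projr (\<sigma> (Inr i))) ` (V - set ts) = V - set ys"
    proof (intro equalityI subsetI)
      fix j assume "j \<in> (\<lambda>i. projr (\<sigma> (Inr i))) ` (V - set ts)"
      then obtain i where i: "i \<in> V - set ts" "j = projr (\<sigma> (Inr i))" by blast
      then have m: "Inr i \<in> W1" using memV by auto
      then have \<sigma>i: "\<sigma> (Inr i) = Inr j" using \<sigma>r[OF m] i by auto
      then have "j \<in> V" using \<sigma>W[OF m] memV by auto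
      moreover have "j \<notin> set ys"
      proof
        assume "j \<in> set ys"
        then obtain x where x: "x \<in> X" "j = y x" using ys by auto
        then have "\<sigma> (Inl x) = \<sigma> (Inr i)" using X\<sigma> \<sigma>i by simp
        then show False using \<sigma>inj[OF XW1[OF x(1)] m] by simp
      qed
      ultimately show "j \<in> V - set ys" by simp
    next
      fix j assume j: "j \<in> V - set ys"
      then obtain r where r: "r \<in> W1" "\<sigma> r = Inr j" using \<sigma>surj[of "Inr j"] memV by auto
      show "j \<in> (\<lambda>i. projr (\<sigma> (Inr i))) ` (V - set ts)"
      proof (cases r)
        case (Inl x)
        then have "x \<in> X" using r memV by (auto simp: X_def)
        then have "j \<in> set ys" using X\<sigma>[of x] r Inl ys by auto
        then show ?thesis using j by simp
      next
        case (Inr i)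
        then have "i \<in> V - set ts" "projr (\<sigma> (Inr i)) = j" using r memV by auto
        then show ?thesis by blast
      qed
    qed
  qed
  \<comment> \<open>The inverse is taken because primed edges run along \<open>D\<close> and
    unprimed edges against it, while \<open>adj_minor_of_matching\<close> expects an edge of
    \<open>D\<close> from \<open>\<tau> i\<close> to \<open>i\<close>.\<close>
  define \<tau>2 where "\<tau>2 = the_inv_into (V - set ts) (\<lambda>i. projr (\<sigma> (Inr i)))"
  have bij2: "bij_betw \<tau>2 (V - set ys) (V - set ts)"
    unfolding \<tau>2_def by (rule bij_betw_the_inv_into[OF \<mu>])
  have \<tau>2: "\<tau>2 j = j \<or> (\<tau>2 j, j) \<in> D" if "j \<in> V - set ys" for j
  proof -
    have t: "\<tau>2 j \<in> V - set ts" using bij2 that by (auto simp: bij_betw_def)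
    then have m: "Inr (\<tau>2 j) \<in> W1" using memV by auto
    have "projr (\<sigma> (Inr (\<tau>2 j))) = j"
      unfolding \<tau>2_def using f_the_inv_into_f_bij_betw[OF \<mu>] that by blast
    then have "\<sigma> (Inr (\<tau>2 j)) = Inr j" using \<sigma>r[OF m] by auto
    then show ?thesis using edge[of "Inr (\<tau>2 j)"] m by (auto simp: W1_def Gflow_edges_cases)
  qed
  have \<tau>1e: "\<tau>1 i = i \<or> (\<tau>1 i, i) \<in> D" if "i \<in> V - X" for i
    using edge[of "Inl i"] memV(1)[of i] \<tau>1[OF that] that by (auto simp: W1_def Gflow_edges_cases)
  obtain L1 where L1: "L1 \<in> RD_reg n D" "subdet (adj_mat (1\<^sub>m n - L1))\<^sup>T ss xs \<noteq> 0"
    using adj_minor_of_matching[of D n xs ss \<tau>1] D xs XV ss lenx bij1 \<tau>1e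
    by (auto simp: V_def k_def)
  obtain L2 where L2: "L2 \<in> RD_reg n D" "subdet (adj_mat (1\<^sub>m n - L2))\<^sup>T ts ys \<noteq> 0"
    using adj_minor_of_matching[of D n ys ts \<tau>2] D ys ysV ts len bij2 \<tau>2
    by (auto simp: V_def k_def)
  have LC: "L1 \<in> carrier_mat n n" "L2 \<in> carrier_mat n n" using L1 L2 by (auto simp: RD_reg_def)
  have xlt: "xs ! a < n" "ys ! a < n" if "a < k" for a
    using that lenx ys xs XV ysV unfolding V_def by (metis atLeastLessThan_iff nth_mem subsetD)+
  \<comment> \<open>One parameter \<open>t\<close> moves from \<open>L1\<close>, good for the
    unprimed half, to \<open>L2\<close>, good for the primed half, in step with the columns of
    \<open>C\<close>.\<close>
  define L where "L = segment_mat n L1 L2"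
  define Ad where "Ad = (\<lambda>t. adj_mat (1\<^sub>m n - L t))"
  define C where "C = (\<lambda>t::real. mat n k (\<lambda>(r,a).
     (if r = xs ! a then 1 - t else 0) + (if r = ys ! a then t else 0)))"
  \<comment> \<open>With \<open>C t * (C t)\<^sup>T\<close> in place of Omega,
    \<open>adj_cov\<close> becomes \<open>U t * (U t)\<^sup>T\<close>, and its minor a product of
    two minors of \<open>U t\<close>, one nonzero at \<open>t = 0\<close> and the other at
    \<open>t = 1\<close>.\<close>
  define U where "U = (\<lambda>t. (Ad t)\<^sup>T * C t)"
  have AC: "1\<^sub>m n - L t \<in> carrier_mat n n" for t by (simp add: L_def minus_carrier_mat)
  have Ad: "Ad t \<in> carrier_mat n n" for t unfolding Ad_def by (rule adj_mat(1)[OF AC])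
  have Ad_eq: "adj_mat (1\<^sub>m n - L t) = Ad t" for t by (simp add: Ad_def)
  have [simp]: "dim_row (Ad t) = n" "dim_col (Ad t) = n" for t using Ad[of t] by auto
  have CC: "C t \<in> carrier_mat n k" for t by (simp add: C_def)
  have UC: "U t \<in> carrier_mat n k" for t using Ad[of t] CC[of t] by (simp add: U_def)
  have pA: "polyfun (\<lambda>t (_::unit). t) (\<lambda>t. (1\<^sub>m n - L t) $$ (i,j))" if "i < n" "j < n" for i j
    using that by (simp add: L_def polyfun_diff pconst polyfun_segment_mat)
  have pAd: "polyfun (\<lambda>t (_::unit). t) (\<lambda>t. Ad t $$ (i,j))" if "i < n" "j < n" for i j
    unfolding Ad_def using that by (intro polyfun_adj_mat[OF AC pA])
  have pid: "polyfun (\<lambda>t (_::unit). t) (\<lambda>t. t)" by (rule pvar)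
  have pif: "polyfun (\<lambda>t (_::unit). t) (\<lambda>t. if Q then f t else 0)"
    if "polyfun (\<lambda>t (_::unit). t) f" for Q and f :: "real \<Rightarrow> real"
    using that by (cases Q) (auto intro: pconst)
  have pC: "polyfun (\<lambda>t (_::unit). t) (\<lambda>t. C t $$ (i,j))" if "i < n" "j < k" for i j
    using that by (simp add: C_def padd pif polyfun_diff pconst pid)
  have pU: "polyfun (\<lambda>t (_::unit). t) (\<lambda>t. U t $$ (i,j))" if "i < n" "j < k" for i j
    unfolding U_def using Ad CC that
    by (intro polyfun_mat_mult[of _ n n _ k] pC) (auto simp: pAd)
  have pS: "polyfun (\<lambda>t (_::unit). t) (\<lambda>t. subdet (U t) q [0..<k])"
    if "set q \<subseteq> V" "length q = k" for q
    using that by (intro polyfun_subdet pU) (auto simp: V_def)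
  have U_ix: "U t $$ (r,a) = (1 - t) * Ad t $$ (xs ! a, r) + t * Ad t $$ (ys ! a, r)"
    if "r < n" "a < k" for t r a
  proof -
    have "U t $$ (r,a) = (\<Sum>m<n. Ad t $$ (m,r) * C t $$ (m,a))"
      using Ad[of t] CC[of t] that by (simp add: U_def scalar_prod_def lessThan_atLeast0)
    also have "\<dots> = (\<Sum>m<n. (if m = xs ! a then (1 - t) * Ad t $$ (xs ! a, r) else 0)
        + (if m = ys ! a then t * Ad t $$ (ys ! a, r) else 0))"
      using that by (intro sum.cong) (auto simp: C_def algebra_simps)
    also have "\<dots> = (1 - t) * Ad t $$ (xs ! a, r) + t * Ad t $$ (ys ! a, r)"
      using xlt[OF that(2)] by (simp add: sum.distrib)
    finally show ?thesis .
  qed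
  have lt: "ss ! i < n" "ts ! i < n" if "i < k" for i
    using that ss ts len unfolding k_def by (metis atLeastLessThan_iff nth_mem subsetD)+
  have U0: "subdet (U 0) ss [0..<k] \<noteq> 0"
  proof -
    have "subdet (U 0) ss [0..<k] = subdet (Ad 0)\<^sup>T ss xs"
      unfolding subdet_def using lt xlt Ad[of 0] lenx
      by (intro arg_cong[of _ _ det] eq_matI) (auto simp: U_ix k_def)
    then show ?thesis using L1 LC by (simp add: Ad_def L_def segment_mat_0)
  qed
  have U1: "subdet (U 1) ts [0..<k] \<noteq> 0"
  proof -
    have "subdet (U 1) ts [0..<k] = subdet (Ad 1)\<^sup>T ts ys"
      unfolding subdet_def using lt xlt Ad[of 1] ys(3) len
      by (intro arg_cong[of _ _ det] eq_matI) (auto simp: U_ix k_def)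
    then show ?thesis using L2 LC by (simp add: Ad_def L_def segment_mat_1)
  qed
  have det0: "det (1\<^sub>m n - L 0) \<noteq> 0"
    using L1 LC invertible_mat_iff_det[of "1\<^sub>m n - L1" n]
    by (simp add: L_def segment_mat_0 RD_reg_def minus_carrier_mat)
  have pD: "polyfun (\<lambda>t (_::unit). t) (\<lambda>t. det (1\<^sub>m n - L t))"
    unfolding L_def by (rule polyfun_det_one_minus_segment)
  have sV: "set ss \<subseteq> V" "length ss = k" and tV: "set ts \<subseteq> V" "length ts = k"
    using ss ts len by (auto simp: V_def k_def)
  obtain t where t: "subdet (U t) ss [0..<k] \<noteq> 0" "subdet (U t) ts [0..<k] \<noteq> 0"
      "det (1\<^sub>m n - L t) \<noteq> 0"
    using polyfun_univariate_common_nonzero[OF pS[OF sV] U0 pS[OF tV] U1 pD det0] by blast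
  \<comment> \<open>The Gram matrix alone may be singular. The minor is polynomial in
    \<open>\<epsilon>\<close> and nonzero at 0, so some positive \<open>\<epsilon>\<close> keeps it
    nonzero and makes \<open>Om \<epsilon>\<close> positive definite.\<close>
  define Om where "Om = (\<lambda>\<epsilon>::real. mat n n (\<lambda>(i,j).
      (\<Sum>a<k. C t $$ (i,a) * C t $$ (j,a)) + (if i = j then \<epsilon> else 0)))"
  have OmC: "Om \<epsilon> \<in> carrier_mat n n" for \<epsilon> by (simp add: Om_def)
  have "Om 0 = C t * (C t)\<^sup>T"
    using CC[of t] by (intro eq_matI) (auto simp: Om_def scalar_prod_def lessThan_atLeast0)
  then have "adj_cov n (L t) (Om 0) = U t * (U t)\<^sup>T"
    using Ad[of t] CC[of t] unfolding adj_cov_def Ad_eq U_def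
    by (simp add: transpose_mult[of _ n n _ k] assoc_mult_mat[of _ n n _ k _ n]
        assoc_mult_mat[of _ n k _ n _ n] assoc_mult_mat[of _ n n _ n _ n] mult_carrier_mat[of _ n k _ n])
  then have F0: "subdet (adj_cov n (L t) (Om 0)) ss ts \<noteq> 0"
    using subdet_mult_transpose[OF UC[of t] sV[unfolded V_def] tV[unfolded V_def]] t(1,2)
    by (simp only: mult_eq_0_iff simp_thms)
  have pF: "polyfun (\<lambda>t (_::unit). t) (\<lambda>\<epsilon>. subdet (adj_cov n (L t) (Om \<epsilon>)) ss ts)"
  proof (rule polyfun_subdet[OF _ len])
    fix i j assume "i \<in> set ss" "j \<in> set ts"
    then have ij: "i < n" "j < n" using ss ts by auto
    have pOm: "polyfun (\<lambda>t (_::unit). t) (\<lambda>\<epsilon>. Om \<epsilon> $$ (i,j))" if "i < n" "j < n" for i j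
      using that by (simp add: Om_def padd pif pconst pid)
    show "polyfun (\<lambda>t (_::unit). t) (\<lambda>\<epsilon>. adj_cov n (L t) (Om \<epsilon>) $$ (i,j))"
      unfolding adj_cov_def Ad_eq using Ad[of t] OmC ij
      by (intro polyfun_mat_mult[of _ n n _ n] pOm pconst) (auto intro!: mult_carrier_mat)
  qed
  obtain \<epsilon> where \<epsilon>: "0 < \<epsilon>" "subdet (adj_cov n (L t) (Om \<epsilon>)) ss ts \<noteq> 0"
    using polyfun_univariate_common_nonzero[OF pF F0 pF F0 pF F0] by blast
  have "Om \<epsilon> \<in> PD_B n B"
    unfolding Om_def
  proof (rule gram_plus_diag_PD_B[OF Bsym _ _ \<epsilon>(1), of k n _ "\<lambda>a. xs ! a" "\<lambda>a. ys ! a"])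
    fix a assume a: "a < k"
    then have x: "xs ! a \<in> X" "ys ! a = y (xs ! a)" using xs lenx by (auto simp: ys_def)
    then show "xs ! a = ys ! a \<or> (xs ! a, ys ! a) \<in> B"
      using edge[of "Inl (xs ! a)"] memV(1)[of "xs ! a"] X\<sigma>[OF x(1)]
      by (auto simp: W1_def Gflow_edges_cases X_def)
  next
    fix a r assume "a < k" "r < n" "C t $$ (r,a) \<noteq> 0"
    then show "r = xs ! a \<or> r = ys ! a" by (auto simp: C_def split: if_splits)
  qed
  moreover have "L t \<in> RD_reg n D"
    unfolding L_def using L1 L2 t(3) by (intro RD_reg_segment) (auto simp: L_def)
  ultimately show ?thesis using \<epsilon>(2) by (intro bexI[of _ "(L t, Om \<epsilon>)"]) (auto simp: Theta_def)
qed

section \<open>The minor of the reduced flow graph\<close>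

lemma row_mult_right_inverse:
  fixes A M :: "real mat"
  assumes A: "A \<in> carrier_mat n n" and M: "M \<in> carrier_mat n n" and AM: "A * M = 1\<^sub>m n" and j: "j < n"
  shows "(\<Sum>c<n. (\<Sum>r<n. b r * A $$ (r,c)) * M $$ (c,j)) = b j"
proof -
  have "(\<Sum>c<n. (\<Sum>r<n. b r * A $$ (r,c)) * M $$ (c,j))
      = (\<Sum>c<n. \<Sum>r<n. b r * (A $$ (r,c) * M $$ (c,j)))"
    by (simp add: sum_distrib_right mult.assoc)
  also have "\<dots> = (\<Sum>r<n. \<Sum>c<n. b r * (A $$ (r,c) * M $$ (c,j)))" by (rule sum.swap)
  also have "\<dots> = (\<Sum>r<n. b r * (A * M) $$ (r,j))"
    using A M j by (intro sum.cong refl)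
      (simp add: scalar_prod_def lessThan_atLeast0 sum_distrib_left)
  also have "\<dots> = (\<Sum>r<n. if r = j then b j else 0)"
    unfolding AM using j by (intro sum.cong) auto
  finally show ?thesis using j by simp
qed

text \<open>\<open>v\<close> and its descendants form a set \<open>R\<close> closed under
  \<open>D\<close>, so the rows of \<open>I - L\<close> from \<open>R\<close> are supported on
  \<open>R\<close>. Counting unknowns yields a vector on \<open>R\<close> that \<open>I - L\<close>
  maps to a multiple of the unit vector at \<open>v\<close>; multiplication by \<open>M\<close>
  shows that it is this multiple of row \<open>v\<close> of \<open>M\<close>.\<close>

lemma inverse_entry_non_descendant:
  fixes L M :: "real mat"
  assumes L: "L \<in> carrier_mat n n" and D: "\<And>i j. i < n \<Longrightarrow> j < n \<Longrightarrow> (i,j) \<notin> D \<Longrightarrow> L $$ (i,j) = 0"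
    and M: "M \<in> carrier_mat n n" "(1\<^sub>m n - L) * M = 1\<^sub>m n"
    and v: "v < n" and t: "t < n" "t \<noteq> v" "t \<notin> des D v"
  shows "M $$ (v,t) = 0"
proof -
  define A where "A = 1\<^sub>m n - L"
  have A: "A \<in> carrier_mat n n" using L by (simp add: A_def minus_carrier_mat)
  define R where "R = {r. r < n \<and> (r = v \<or> r \<in> des D v)}"
  have R: "finite R" "v \<in> R" "t \<notin> R" using v t by (auto simp: R_def)
  have closed: "A $$ (r,c) = 0" if "r \<in> R" "c < n" "c \<notin> R" for r c
  proof -
    have "(r,c) \<notin> D" using that by (auto simp: R_def des_def intro: trancl.intros)
    then show ?thesis using that L D[of r c] by (auto simp: A_def R_def)
  qed
  \<comment> \<open>The extra unknown \<open>None\<close> is the multiple of the unit vector at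
    \<open>v\<close>; it makes the unknowns exceed the equations by one.\<close>
  define F where "F = (\<lambda>x c. case x of None \<Rightarrow> (if c = v then - 1 else 0 :: real) | Some r \<Rightarrow> A $$ (r,c))"
  have "card R < card (insert None (Some ` R))"
    using R(1) by (simp add: card_image)
  from underdetermined_system[OF R(1) _ this, of F] R(1)
  obtain b where b: "\<exists>x\<in>insert None (Some ` R). b x \<noteq> 0"
    and eq: "\<And>c. c \<in> R \<Longrightarrow> (\<Sum>x\<in>insert None (Some ` R). b x * F x c) = 0" by auto
  define b' where "b' = (\<lambda>r. if r \<in> R then b (Some r) else 0)"
  have row: "(\<Sum>r<n. b' r * A $$ (r,c)) = (if c = v then b None else 0)" if c: "c < n" for c
  proof -
    have "(\<Sum>r<n. b' r * A $$ (r,c)) = (\<Sum>r\<in>R. b (Some r) * A $$ (r,c))"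
      by (rule sum.mono_neutral_cong_right) (auto simp: b'_def R_def)
    also have "\<dots> = (if c = v then b None else 0)"
    proof (cases "c \<in> R")
      case True
      then show ?thesis using eq[OF True] R(1) by (auto simp: sum.reindex F_def)
    next
      case False
      then show ?thesis using closed c R(2) by auto
    qed
    finally show ?thesis .
  qed
  have b'M: "b' j = b None * M $$ (v,j)" if j: "j < n" for j
  proof -
    have "b' j = (\<Sum>c<n. (\<Sum>r<n. b' r * A $$ (r,c)) * M $$ (c,j))"
      using row_mult_right_inverse[OF A M(1) _ j, of b'] M(2) by (simp add: A_def)
    also have "\<dots> = (\<Sum>c<n. if c = v then b None * M $$ (v,j) else 0)"
      by (intro sum.cong) (auto simp: row)
    finally show ?thesis using v by simp
  qed
  have "b None \<noteq> 0"
  proof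
    assume 0: "b None = 0"
    then have "b (Some r) = 0" if "r \<in> R" for r
      using b'M[of r] that by (simp add: b'_def R_def)
    then show False using b 0 by auto
  qed
  then show ?thesis using b'M[OF t(1)] R(3) by (simp add: b'_def)
qed

lemma sum_over_Plus_extend:
  fixes b :: "nat + nat \<Rightarrow> real"
  assumes "R \<subseteq> Gflow_verts n"
  shows "(\<Sum>r\<in>R. b r * g r)
    = (\<Sum>i<n. (if Inl i \<in> R then b (Inl i) else 0) * g (Inl i))
    + (\<Sum>i<n. (if Inr i \<in> R then b (Inr i) else 0) * g (Inr i))"
proof -
  have "(\<Sum>r\<in>R. b r * g r) = (\<Sum>r\<in>Gflow_verts n. (if r \<in> R then b r else 0) * g r)"
    by (rule sum.mono_neutral_cong_left) (use assms in \<open>auto simp: Gflow_verts_def\<close>)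
  also have "\<dots> = (\<Sum>r\<in>Inl ` {0..<n}. (if r \<in> R then b r else 0) * g r)
      + (\<Sum>r\<in>Inr ` {0..<n}. (if r \<in> R then b r else 0) * g r)"
    unfolding Gflow_verts_def by (rule sum.union_disjoint) auto
  finally show ?thesis by (simp add: sum.reindex lessThan_atLeast0)
qed

text \<open>The violator R yields a row vector supported on R that is mapped by the block matrix
  with rows (I - L^T, -Omega) and (0, I - L*) to a vector supported on S; here L* is L without
  the entries of Ws in column v, so the second block row matches the reduced flow graph.\<close>

lemma cov_left_null_vector:
  assumes G: "mixed_graph n D B" and \<theta>: "\<theta> \<in> Theta n D B" and v: "v < n"
    and Ws: "\<And>w. w \<in> Ws \<Longrightarrow> (w,v) \<in> D"
    and S: "S \<subseteq> {0..<n}" and T: "T \<subseteq> {0..<n} - {v}"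
    and des: "des D v \<inter> (T \<union> {v}) = {}"
    and E: "E = Gflow_edges n D B - {(Inr w, Inr v) | w. w \<in> Ws}"
    and R: "R \<subseteq> Gflow_verts n - Inr ` (T \<union> {v})"
    and viol: "card ((R \<union> E `` R) - Inl ` S) < card R"
  shows "\<exists>a. (\<exists>s\<in>S. a s \<noteq> 0) \<and> (\<forall>t\<in>T. (\<Sum>s\<in>S. a s * phiG n \<theta> $$ (s,t)) = 0) \<and>
    (\<Sum>s\<in>S. a s * (phiG n \<theta> $$ (s,v) - (\<Sum>w\<in>Ws. fst \<theta> $$ (w,v) * phiG n \<theta> $$ (s,w)))) = 0"
proof -
  obtain L Om where \<theta>_eq: "\<theta> = (L, Om)" by (cases \<theta>)
  have LR: "L \<in> RD_reg n D" and OmP: "Om \<in> PD_B n B" using \<theta> by (auto simp: \<theta>_eq Theta_def)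
  have L: "L \<in> carrier_mat n n" and LD: "\<And>i j. i < n \<Longrightarrow> j < n \<Longrightarrow> (i,j) \<notin> D \<Longrightarrow> L $$ (i,j) = 0"
    and inv: "invertible_mat (1\<^sub>m n - L)" using LR by (auto simp: RD_reg_def)
  have Om: "Om \<in> carrier_mat n n"
    and OmB: "\<And>i j. i < n \<Longrightarrow> j < n \<Longrightarrow> i \<noteq> j \<Longrightarrow> (i,j) \<notin> B \<Longrightarrow> Om $$ (i,j) = 0"
    using OmP by (auto simp: PD_B_def pos_def_mat_def)
  define A where "A = 1\<^sub>m n - L"
  have A: "A \<in> carrier_mat n n" using L by (simp add: A_def minus_carrier_mat)
  define M where "M = mat_inv A"
  have M: "M \<in> carrier_mat n n" "A * M = 1\<^sub>m n" "M * A = 1\<^sub>m n"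
    using mat_inv[OF A] inv by (auto simp: M_def A_def)
  have Aij: "A $$ (i,j) = (if i = j then 1 else 0) - L $$ (i,j)" if "i < n" "j < n" for i j
    using that L by (auto simp: A_def)
  have DV: "D \<subseteq> {0..<n} \<times> {0..<n}" and noloop: "\<And>i. (i,i) \<notin> D" using G by (auto simp: mixed_graph_def)
  have WsV: "Ws \<subseteq> {0..<n}" using Ws DV by auto
  have finWs: "finite Ws" using WsV by (rule finite_subset) simp

  have M0: "M $$ (v,t) = 0" if "t < n" "t \<noteq> v" "t \<notin> des D v" for t
    using inverse_entry_non_descendant[OF L LD M(1) _ v that] M(2) by (simp add: A_def)
  \<comment> \<open>A parent of \<open>v\<close> among its descendants would close a cycle through
    \<open>v\<close>, which \<open>des\<close> excludes.\<close>
  have Mpa: "M $$ (v,i) = 0" if "(i,v) \<in> D" for i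
  proof (rule M0)
    show "i < n" using that DV by auto
    show "i \<noteq> v" using that noloop by auto
    show "i \<notin> des D v" using that des by (auto simp: des_def dest: trancl_into_trancl)
  qed
  \<comment> \<open>In entry \<open>(v,v)\<close> of \<open>M * A = I\<close> every other term
    vanishes: \<open>A\<close> is zero at non-parents of \<open>v\<close>, and \<open>M\<close> at
    parents.\<close>
  have Mvv: "M $$ (v,v) = 1"
  proof -
    have "1 = (M * A) $$ (v,v)" using v by (simp add: M(3))
    also have "\<dots> = (\<Sum>i<n. M $$ (v,i) * A $$ (i,v))"
      using M(1) A v by (simp add: scalar_prod_def lessThan_atLeast0)
    also have "\<dots> = (\<Sum>i<n. if i = v then M $$ (v,v) else 0)"
      using Mpa LD v noloop by (intro sum.cong refl) (auto simp: Aij)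
    finally show ?thesis using v by simp
  qed

  define F where "F = (\<lambda>r c. case (r,c) of
      (Inl i, Inl j) \<Rightarrow> A $$ (j,i)
    | (Inl i, Inr j) \<Rightarrow> - Om $$ (i,j)
    | (Inr i, Inl j) \<Rightarrow> 0
    | (Inr i, Inr j) \<Rightarrow> A $$ (i,j) + (if j = v \<and> i \<in> Ws then L $$ (i,v) else 0))"
  have F_supp: "c = r \<or> (r,c) \<in> E" if "r \<in> Gflow_verts n" "c \<in> Gflow_verts n" "F r c \<noteq> 0" for r c
  proof (cases r; cases c)
    fix i j assume rc: "r = Inl i" "c = Inl j"
    then have ij: "i < n" "j < n" using that by (auto simp: Gflow_verts_def)
    then have "i = j \<or> (j,i) \<in> D" using that(3) LD[of j i] by (auto simp: rc F_def Aij split: if_splits)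
    then show ?thesis by (auto simp: rc E Gflow_edges_cases)
  next
    fix i j assume rc: "r = Inl i" "c = Inr j"
    then have ij: "i < n" "j < n" using that by (auto simp: Gflow_verts_def)
    then have "i = j \<or> (i,j) \<in> B" using that(3) OmB[of i j] by (auto simp: rc F_def)
    then show ?thesis using ij by (auto simp: rc E Gflow_edges_cases)
  next
    fix i j assume rc: "r = Inr i" "c = Inl j"
    then show ?thesis using that(3) by (auto simp: F_def)
  next
    fix i j assume rc: "r = Inr i" "c = Inr j"
    then have ij: "i < n" "j < n" using that by (auto simp: Gflow_verts_def)
    show ?thesis
    proof (cases "j = v \<and> i \<in> Ws")
      case True
      then show ?thesis using that(3) ij by (auto simp: rc F_def Aij split: if_splits)
    next
      case False
      then have "i = j \<or> (i,j) \<in> D" using that(3) LD[OF ij] ij by (auto simp: rc F_def Aij split: if_splits)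
      then show ?thesis using False by (auto simp: rc E Gflow_edges_cases)
    qed
  qed
  have EV: "E \<subseteq> Gflow_verts n \<times> Gflow_verts n" using Gflow_edges_subset[OF G] by (auto simp: E)
  have finV: "finite (Gflow_verts n)" by (simp add: Gflow_verts_def)
  have RV: "R \<subseteq> Gflow_verts n" using R by auto
  have finR: "finite R" and finN: "finite ((R \<union> E `` R) - Inl ` S)"
    using RV EV finV by (auto intro: finite_subset)
  from underdetermined_system[OF finN finR viol, of F]
  obtain b where b: "\<exists>r\<in>R. b r \<noteq> 0"
    and bN: "\<And>c. c \<in> (R \<union> E `` R) - Inl ` S \<Longrightarrow> (\<Sum>r\<in>R. b r * F r c) = 0" by blast
  \<comment> \<open>A column outside \<open>R\<close> and its successors is zero on all rows of
    \<open>R\<close>, so its equation comes for free.\<close>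
  have bF: "(\<Sum>r\<in>R. b r * F r c) = 0" if c: "c \<in> Gflow_verts n" "c \<notin> Inl ` S" for c
  proof (cases "c \<in> R \<union> E `` R")
    case True
    then show ?thesis using bN c by auto
  next
    case False
    have "F r c = 0" if "r \<in> R" for r
      using F_supp[of r c] that RV c(1) False by blast
    then show ?thesis by simp
  qed
  define b1 where "b1 = (\<lambda>i. if Inl i \<in> R then b (Inl i) else 0)"
  define b2 where "b2 = (\<lambda>i. if Inr i \<in> R then b (Inr i) else 0)"
  have sumR: "(\<Sum>r\<in>R. b r * F r c) = (\<Sum>i<n. b1 i * F (Inl i) c) + (\<Sum>i<n. b2 i * F (Inr i) c)" for c
    unfolding b1_def b2_def by (rule sum_over_Plus_extend[OF RV])
  \<comment> \<open>\<open>a\<close> is the image on the unprimed columns. Replacing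
    \<open>L\<close> by \<open>L*\<close> in the product of \<open>b2\<close> and
    \<open>I - L\<close> changes only column \<open>v\<close>, and there by
    \<open>\<beta>\<close>.\<close>
  define a where "a = (\<lambda>j. \<Sum>i<n. b1 i * A $$ (j,i))"
  define \<beta> where "\<beta> = (\<Sum>w\<in>Ws. L $$ (w,v) * b2 w)"
  have a0: "a j = 0" if "j < n" "j \<notin> S" for j
    using bF[of "Inl j"] that sumR[of "Inl j"] by (auto simp: Gflow_verts_def F_def a_def)
  have o: "(\<Sum>i<n. b1 i * Om $$ (i,j)) = (\<Sum>i<n. b2 i * A $$ (i,j)) + (if j = v then \<beta> else 0)"
    if j: "j < n" for j
  proof -
    have "0 = - (\<Sum>i<n. b1 i * Om $$ (i,j))
        + (\<Sum>i<n. b2 i * (A $$ (i,j) + (if j = v \<and> i \<in> Ws then L $$ (i,v) else 0)))"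
      using bF[of "Inr j"] j sumR[of "Inr j"] by (auto simp: Gflow_verts_def F_def sum_negf)
    also have "(\<Sum>i<n. b2 i * (A $$ (i,j) + (if j = v \<and> i \<in> Ws then L $$ (i,v) else 0)))
        = (\<Sum>i<n. b2 i * A $$ (i,j)) + (\<Sum>i<n. if j = v \<and> i \<in> Ws then L $$ (i,v) * b2 i else 0)"
      unfolding sum.distrib[symmetric] by (intro sum.cong) (auto simp: algebra_simps)
    also have "(\<Sum>i<n. if j = v \<and> i \<in> Ws then L $$ (i,v) * b2 i else 0) = (if j = v then \<beta> else 0)"
    proof (cases "j = v")
      case True
      have "(\<Sum>i<n. if i \<in> Ws then L $$ (i,v) * b2 i else 0) = \<beta>"
        unfolding \<beta>_def using WsV by (intro sum.mono_neutral_cong_right) auto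
      then show ?thesis using True by simp
    qed simp
    finally show ?thesis by simp
  qed
  have b1M: "b1 i = (\<Sum>s<n. a s * M $$ (i,s))" if "i < n" for i
  proof -
    have "A\<^sup>T * M\<^sup>T = 1\<^sub>m n" using transpose_mult[OF M(1) A] by (simp add: M(3))
    from row_mult_right_inverse[OF _ _ this that, of b1] A M(1) that show ?thesis
      by (simp add: a_def)
  qed
  define Sig where "Sig = phiG n \<theta>"
  have Sig: "Sig $$ (s,t) = (\<Sum>j<n. (\<Sum>i<n. M $$ (i,s) * Om $$ (i,j)) * M $$ (j,t))"
    if "s < n" "t < n" for s t
    using that M(1) Om unfolding Sig_def phiG_def \<theta>_eq fst_conv snd_conv A_def[symmetric] M_def[symmetric]
    by (simp add: scalar_prod_def lessThan_atLeast0 sum_distrib_left sum_distrib_right mult.assoc)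
      (rule sum.swap)
  \<comment> \<open>Since \<open>a\<close> is \<open>A\<close> applied to \<open>b1\<close>,
    multiplying \<open>Sig\<close> by \<open>a\<close> cancels the left inverse and leaves
    \<open>b1\<close> times \<open>Om * M\<close>; by \<open>o\<close> this is \<open>b2\<close>
    plus \<open>\<beta>\<close> times row \<open>v\<close> of \<open>M\<close>.\<close>
  have aSig: "(\<Sum>s\<in>S. a s * Sig $$ (s,t)) = b2 t + \<beta> * M $$ (v,t)" if t: "t < n" for t
  proof -
    have "(\<Sum>s\<in>S. a s * Sig $$ (s,t)) = (\<Sum>s<n. a s * Sig $$ (s,t))"
      using S a0 by (intro sum.mono_neutral_left) auto
    also have "\<dots> = (\<Sum>s<n. \<Sum>j<n. a s * (\<Sum>i<n. M $$ (i,s) * Om $$ (i,j)) * M $$ (j,t))"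
      using t by (intro sum.cong refl, subst Sig, simp, simp, subst sum_distrib_left)
        (simp add: mult.assoc)
    also have "\<dots> = (\<Sum>j<n. (\<Sum>s<n. a s * (\<Sum>i<n. M $$ (i,s) * Om $$ (i,j))) * M $$ (j,t))"
      by (subst sum.swap) (simp add: sum_distrib_right)
    also have "\<dots> = (\<Sum>j<n. (\<Sum>i<n. b1 i * Om $$ (i,j)) * M $$ (j,t))"
    proof (rule sum.cong[OF refl])
      fix j
      have "(\<Sum>s<n. a s * (\<Sum>i<n. M $$ (i,s) * Om $$ (i,j)))
          = (\<Sum>s<n. \<Sum>i<n. a s * M $$ (i,s) * Om $$ (i,j))"
        by (simp add: sum_distrib_left mult.assoc)
      also have "\<dots> = (\<Sum>i<n. \<Sum>s<n. a s * M $$ (i,s) * Om $$ (i,j))" by (rule sum.swap)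
      also have "\<dots> = (\<Sum>i<n. b1 i * Om $$ (i,j))"
        by (intro sum.cong refl) (simp add: b1M sum_distrib_right)
      finally show "(\<Sum>s<n. a s * (\<Sum>i<n. M $$ (i,s) * Om $$ (i,j))) * M $$ (j,t)
          = (\<Sum>i<n. b1 i * Om $$ (i,j)) * M $$ (j,t)" by (rule arg_cong)
    qed
    also have "\<dots> = (\<Sum>j<n. (\<Sum>i<n. b2 i * A $$ (i,j)) * M $$ (j,t) + (if j = v then \<beta> * M $$ (v,t) else 0))"
      by (intro sum.cong refl) (auto simp: o algebra_simps)
    also have "\<dots> = b2 t + \<beta> * M $$ (v,t)"
      using row_mult_right_inverse[OF A M(1,2) t, of b2] v by (simp add: sum.distrib)
    finally show ?thesis .
  qed
  have b2T: "b2 t = 0" if "t \<in> T \<union> {v}" for t using that R by (auto simp: b2_def)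
  \<comment> \<open>\<open>a = 0\<close> forces \<open>b1 = 0\<close> by invertibility. Column
    \<open>v\<close> then reads \<open>\<beta> = 0\<close>, since \<open>b2\<close> vanishes at the
    sink \<open>v\<close> and \<open>M $$ (v,v) = 1\<close>, so \<open>b2 = 0\<close> as
    well.\<close>
  have "\<exists>s\<in>S. a s \<noteq> 0"
  proof (rule ccontr)
    assume "\<not> ?thesis"
    then have aS: "a s = 0" if "s \<in> S" for s using that by blast
    then have "a s = 0" if "s < n" for s using a0 that by blast
    then have b10: "b1 i = 0" if "i < n" for i using b1M[OF that] by simp
    have b2\<beta>: "b2 t + \<beta> * M $$ (v,t) = 0" if "t < n" for t using aSig[OF that] aS by simp
    then have "\<beta> = 0" using v Mvv b2T[of v] by fastforce
    then have "b2 i = 0" if "i < n" for i using b2\<beta> that by simp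
    then have "b r = 0" if "r \<in> R" for r
      using that RV b10 by (cases r) (force simp: b1_def b2_def Gflow_verts_def)+
    then show False using b by blast
  qed
  moreover have "(\<Sum>s\<in>S. a s * Sig $$ (s,t)) = 0" if "t \<in> T" for t
  proof -
    have "t < n" "t \<noteq> v" "t \<notin> des D v" using that T des by auto
    then show ?thesis using aSig[of t] M0[of t] b2T[of t] that by simp
  qed
  \<comment> \<open>Column \<open>v\<close> gives \<open>\<beta>\<close>. The columns in
    \<open>Ws\<close> give \<open>b2 w\<close>, because row \<open>v\<close> of \<open>M\<close>
    vanishes at parents, and their weighted sum is again \<open>\<beta>\<close>.\<close>
  moreover have "(\<Sum>s\<in>S. a s * (Sig $$ (s,v) - (\<Sum>w\<in>Ws. L $$ (w,v) * Sig $$ (s,w)))) = 0"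
  proof -
    have "(\<Sum>s\<in>S. a s * (Sig $$ (s,v) - (\<Sum>w\<in>Ws. L $$ (w,v) * Sig $$ (s,w))))
        = (\<Sum>s\<in>S. a s * Sig $$ (s,v)) - (\<Sum>s\<in>S. \<Sum>w\<in>Ws. L $$ (w,v) * (a s * Sig $$ (s,w)))"
      by (simp add: right_diff_distrib sum_subtractf sum_distrib_left ac_simps)
    also have "(\<Sum>s\<in>S. \<Sum>w\<in>Ws. L $$ (w,v) * (a s * Sig $$ (s,w)))
        = (\<Sum>w\<in>Ws. L $$ (w,v) * (\<Sum>s\<in>S. a s * Sig $$ (s,w)))"
      by (subst sum.swap) (simp add: sum_distrib_left)
    also have "\<dots> = (\<Sum>w\<in>Ws. L $$ (w,v) * b2 w)"
      using WsV Ws Mpa by (intro sum.cong refl) (auto simp: aSig)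
    finally show ?thesis using aSig[OF v] Mvv b2T[of v] by (simp add: \<beta>_def)
  qed
  ultimately show ?thesis unfolding Sig_def \<theta>_eq by (intro exI[of _ a]) auto
qed

section \<open>Identifiability\<close>

text \<open>Laplace expansion along the last column. Its cofactors do not see that column, so a
  single \<open>C\<close> serves every \<open>w\<close> and every \<open>y\<close>, and linear
  relations between columns pass to minors.\<close>

lemma subdet_append_column_linear:
  assumes "length ss = Suc (length ts)"
  shows "\<exists>C. (\<forall>w. subdet M ss (ts @ [w]) = (\<Sum>i<length ss. C i * M $$ (ss ! i, w))) \<and>
    (\<forall>y. det (mat (length ss) (length ss) (\<lambda>(i,j). if j < length ts then M $$ (ss ! i, ts ! j) else y i))
       = (\<Sum>i<length ss. C i * y i))"
proof -
  define k where "k = length ss"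
  define m where "m = length ts"
  have km: "k = Suc m" using assms by (simp add: k_def m_def)
  define Q where "Q = (\<lambda>y. mat k k (\<lambda>(i,j). if j < m then M $$ (ss ! i, ts ! j) else y i))"
  define C where "C = (\<lambda>i. cofactor (Q (\<lambda>_. 0)) i m)"
  have cof: "cofactor (Q y) i m = C i" for y i
  proof -
    have "mat_delete (Q y) i m = mat_delete (Q (\<lambda>_. 0)) i m"
      by (intro eq_matI) (auto simp: mat_delete_def Q_def km)
    then show ?thesis by (simp add: C_def cofactor_def)
  qed
  have det: "det (Q y) = (\<Sum>i<k. C i * y i)" for y
  proof -
    have "det (Q y) = (\<Sum>i<k. Q y $$ (i,m) * cofactor (Q y) i m)"
      by (rule laplace_expansion_column) (auto simp: Q_def km)
    then show ?thesis by (simp add: cof) (auto simp: Q_def km intro!: sum.cong)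
  qed
  have "subdet M ss (ts @ [w]) = det (Q (\<lambda>i. M $$ (ss ! i, w)))" for w
    unfolding subdet_def Q_def using km
    by (intro arg_cong[of _ _ det] eq_matI) (auto simp: k_def m_def nth_append less_Suc_eq)
  then show ?thesis using det
    by (intro exI[of _ C]) (simp add: Q_def k_def m_def)
qed

section \<open>Generic points of the parameter space\<close>

lemma polyfun_hypersurface_proper:
  assumes "polyfun param_coords g" "\<theta>0 \<in> \<Theta>" "g \<theta>0 \<noteq> 0"
  shows "proper_algebraic_subset \<Theta> {\<theta>\<in>\<Theta>. g \<theta> = 0}"
  unfolding proper_algebraic_subset_def algebraic_subset_def
  using assms by (intro conjI exI[of _ "{g}"]) auto

text \<open>One polynomial replaces the finite family, so that unions of exceptional sets turn into
  products.\<close>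

lemma proper_algebraic_subset_in_hypersurface:
  assumes "proper_algebraic_subset \<Theta> A"
  shows "\<exists>f. polyfun param_coords f \<and> (\<exists>\<theta>\<in>\<Theta>. f \<theta> \<noteq> 0) \<and> (\<forall>\<theta>\<in>A. f \<theta> = 0)"
proof -
  obtain F where F: "\<forall>f\<in>F. polyfun param_coords f" "A = {\<theta>\<in>\<Theta>. \<forall>f\<in>F. f \<theta> = 0}" "A \<noteq> \<Theta>"
    using assms by (auto simp: proper_algebraic_subset_def algebraic_subset_def)
  then obtain \<theta> f where "\<theta> \<in> \<Theta>" "f \<in> F" "f \<theta> \<noteq> 0" by blast
  then show ?thesis using F by blast
qed

text \<open>The product of \<open>g\<close> with one polynomial per \<open>w\<close> works;
  irreducibility of \<open>Theta\<close> keeps it from vanishing identically.\<close>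

lemma common_generic_polyfun:
  assumes "\<forall>w\<in>set ws. \<exists>A. proper_algebraic_subset (Theta n D B) A \<and> (\<forall>\<theta>\<in>Theta n D B - A. Q w \<theta>)"
    and "polyfun param_coords g" "\<exists>\<theta>\<in>Theta n D B. g \<theta> \<noteq> 0"
  shows "\<exists>f. polyfun param_coords f \<and> (\<exists>\<theta>\<in>Theta n D B. f \<theta> \<noteq> 0) \<and>
    (\<forall>\<theta>\<in>Theta n D B. f \<theta> \<noteq> 0 \<longrightarrow> g \<theta> \<noteq> 0 \<and> (\<forall>w\<in>set ws. Q w \<theta>))"
  using assms(1)
proof (induction ws)
  case Nil
  then show ?case using assms(2,3) by (intro exI[of _ g]) auto
next
  case (Cons w ws)
  have "\<forall>w\<in>set ws. \<exists>A. proper_algebraic_subset (Theta n D B) A \<and> (\<forall>\<theta>\<in>Theta n D B - A. Q w \<theta>)"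
    using Cons.prems by simp
  from Cons.IH[OF this] obtain f where f: "polyfun param_coords f" "\<exists>\<theta>\<in>Theta n D B. f \<theta> \<noteq> 0"
    "\<And>\<theta>. \<theta> \<in> Theta n D B \<Longrightarrow> f \<theta> \<noteq> 0 \<Longrightarrow> g \<theta> \<noteq> 0 \<and> (\<forall>w\<in>set ws. Q w \<theta>)" by blast
  obtain A where A: "proper_algebraic_subset (Theta n D B) A" "\<And>\<theta>. \<theta> \<in> Theta n D B - A \<Longrightarrow> Q w \<theta>"
    using Cons.prems by (meson list.set_intros(1))
  obtain h where h: "polyfun param_coords h" "\<exists>\<theta>\<in>Theta n D B. h \<theta> \<noteq> 0" "\<And>\<theta>. \<theta> \<in> A \<Longrightarrow> h \<theta> = 0"
    using proper_algebraic_subset_in_hypersurface[OF A(1)] by auto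
  have "\<exists>\<theta>\<in>Theta n D B. f \<theta> * h \<theta> \<noteq> 0"
    using f(1,2) h(1,2) Theta_irreducible by blast
  moreover have "polyfun param_coords (\<lambda>\<theta>. f \<theta> * h \<theta>)" using f(1) h(1) by (rule pmult)
  moreover have "g \<theta> \<noteq> 0 \<and> (\<forall>w'\<in>set (w # ws). Q w' \<theta>)"
    if "\<theta> \<in> Theta n D B" "f \<theta> * h \<theta> \<noteq> 0" for \<theta>
    using that f(3)[of \<theta>] A(2)[of \<theta>] h(3)[of \<theta>] by auto
  ultimately show ?case by blast
qed

text \<open>A common denominator, since rational identifiability asks for a single quotient of
  polynomials.\<close>

lemma rational_combination:
  assumes "\<And>w. w \<in> set ws \<Longrightarrow> polyfun c (p w) \<and> polyfun c (q w) \<and> polyfun c (d w)"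
  shows "\<exists>P Q. polyfun c P \<and> polyfun c Q \<and> (\<forall>x. (\<forall>w\<in>set ws. q w x \<noteq> 0) \<longrightarrow>
    Q x \<noteq> 0 \<and> P x / Q x = (\<Sum>w\<leftarrow>ws. p w x / q w x * d w x))"
  using assms
proof (induction ws)
  case Nil
  show ?case by (intro exI[of _ "\<lambda>_. 0"] exI[of _ "\<lambda>_. 1"]) (simp add: pconst)
next
  case (Cons w ws)
  then obtain P Q where PQ: "polyfun c P" "polyfun c Q"
    "\<And>x. (\<forall>w\<in>set ws. q w x \<noteq> 0) \<Longrightarrow> Q x \<noteq> 0 \<and> P x / Q x = (\<Sum>w\<leftarrow>ws. p w x / q w x * d w x)"
    by auto
  have "polyfun c (\<lambda>x. p w x * d w x * Q x + P x * q w x)" "polyfun c (\<lambda>x. q w x * Q x)"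
    using Cons.prems[of w] PQ(1,2) by (auto intro!: padd pmult)
  moreover have "q w x * Q x \<noteq> 0 \<and> (p w x * d w x * Q x + P x * q w x) / (q w x * Q x)
      = (\<Sum>w\<leftarrow>w # ws. p w x / q w x * d w x)" if "\<forall>w\<in>set (w # ws). q w x \<noteq> 0" for x
  proof -
    have "q w x \<noteq> 0" "Q x \<noteq> 0" "(\<Sum>w\<leftarrow>ws. p w x / q w x * d w x) = P x / Q x"
      using that PQ(3)[of x] by auto
    then show ?thesis by (simp add: field_simps)
  qed
  ultimately show ?case by blast
qed

section \<open>The denominator as a polynomial in the parameters\<close>

definition mat_trunc :: "nat \<Rightarrow> real mat \<Rightarrow> real mat" where
  "mat_trunc n M = mat n n (\<lambda>(i,j). M $$ (i,j))"

lemma mat_trunc_carrier [simp]: "mat_trunc n M \<in> carrier_mat n n"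
  by (simp add: mat_trunc_def)

lemma mat_trunc_id: "M \<in> carrier_mat n n \<Longrightarrow> mat_trunc n M = M"
  by (auto simp: mat_trunc_def)

text \<open>Truncation makes the minor a polynomial in the coordinates on all pairs of matrices, whatever
  their dimensions, as polyfun requires.\<close>

lemma polyfun_adj_cov_minor:
  assumes "set ss \<subseteq> {0..<n}" "set ts \<subseteq> {0..<n}" "length ss = length ts"
  shows "polyfun param_coords (\<lambda>\<theta>. subdet (adj_cov n (mat_trunc n (fst \<theta>)) (mat_trunc n (snd \<theta>))) ss ts)"
proof (rule polyfun_subdet[OF _ assms(3)])
  fix i j assume "i \<in> set ss" "j \<in> set ts"
  then have ij: "i < n" "j < n" using assms by auto
  have pL: "polyfun param_coords (\<lambda>\<theta>. fst \<theta> $$ (i,j))" for i j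
    using pvar[of param_coords "(True,i,j)"] by (simp add: param_coords_def)
  have pO: "polyfun param_coords (\<lambda>\<theta>. snd \<theta> $$ (i,j))" for i j
    using pvar[of param_coords "(False,i,j)"] by (simp add: param_coords_def)
  define Ad where "Ad = (\<lambda>\<theta> :: real mat \<times> real mat. adj_mat (1\<^sub>m n - mat_trunc n (fst \<theta>)))"
  have AC: "1\<^sub>m n - mat_trunc n (fst \<theta>) \<in> carrier_mat n n" for \<theta> :: "real mat \<times> real mat"
    by (simp add: minus_carrier_mat)
  have Ad: "Ad \<theta> \<in> carrier_mat n n" for \<theta> unfolding Ad_def by (rule adj_mat(1)[OF AC])
  have [simp]: "dim_row (Ad \<theta>) = n" "dim_col (Ad \<theta>) = n" for \<theta> using Ad[of \<theta>] by auto
  have pAd: "polyfun param_coords (\<lambda>\<theta>. Ad \<theta> $$ (i,j))" if "i < n" "j < n" for i j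
    unfolding Ad_def
  proof (rule polyfun_adj_mat[OF AC _ that])
    fix i j assume "i < n" "j < n"
    then have "(1\<^sub>m n - mat_trunc n (fst \<theta>)) $$ (i,j) = (if i = j then 1 else 0) - fst \<theta> $$ (i,j)"
      for \<theta> :: "real mat \<times> real mat" by (simp add: mat_trunc_def)
    then show "polyfun param_coords (\<lambda>\<theta>. (1\<^sub>m n - mat_trunc n (fst \<theta>)) $$ (i,j))"
      using polyfun_diff[OF pconst pL] by presburger
  qed
  have cov: "adj_cov n (mat_trunc n (fst \<theta>)) (mat_trunc n (snd \<theta>)) = (Ad \<theta>)\<^sup>T * mat_trunc n (snd \<theta>) * Ad \<theta>" for \<theta>
    by (simp add: adj_cov_def Ad_def)
  show "polyfun param_coords (\<lambda>\<theta>. adj_cov n (mat_trunc n (fst \<theta>)) (mat_trunc n (snd \<theta>)) $$ (i,j))"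
    unfolding cov using ij Ad
    by (intro polyfun_mat_mult[of _ n n _ n]) (auto intro!: mult_carrier_mat pAd pO simp: mat_trunc_def)
qed

lemma subdet_smult:
  assumes "M \<in> carrier_mat n n" "set rs \<subseteq> {0..<n}" "set cs \<subseteq> {0..<n}" "length rs = length cs"
  shows "subdet (c \<cdot>\<^sub>m M) rs cs = c ^ length cs * subdet M rs cs"
proof -
  have lt: "rs ! i < n" "cs ! i < n" if "i < length cs" for i
    using that assms by (metis atLeastLessThan_iff nth_mem subsetD)+
  have "mat (length rs) (length cs) (\<lambda>(i,j). (c \<cdot>\<^sub>m M) $$ (rs ! i, cs ! j))
      = c \<cdot>\<^sub>m mat (length rs) (length cs) (\<lambda>(i,j). M $$ (rs ! i, cs ! j))"
    using assms(1,4) lt by (intro eq_matI) auto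
  then show ?thesis by (simp add: subdet_def)
qed

lemma adj_cov_minor_iff:
  assumes \<theta>: "\<theta> \<in> Theta n D B"
    and "set rs \<subseteq> {0..<n}" "set cs \<subseteq> {0..<n}" "length rs = length cs"
  shows "subdet (adj_cov n (fst \<theta>) (snd \<theta>)) rs cs = 0 \<longleftrightarrow> subdet (phiG n \<theta>) rs cs = 0"
proof -
  define A where "A = 1\<^sub>m n - fst \<theta>"
  have A: "A \<in> carrier_mat n n" "invertible_mat A"
    using \<theta> by (auto simp: Theta_def RD_reg_def A_def minus_carrier_mat)
  have Om: "snd \<theta> \<in> carrier_mat n n" using \<theta> by (auto simp: Theta_def PD_B_def pos_def_mat_def)
  define M where "M = mat_inv A"
  have M: "M \<in> carrier_mat n n" unfolding M_def by (rule mat_inv(1)[OF A])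
  have d: "det A \<noteq> 0" using A invertible_mat_iff_det by blast
  have phi: "phiG n \<theta> = M\<^sup>T * snd \<theta> * M" by (simp add: phiG_def M_def A_def)
  have tr: "(det A \<cdot>\<^sub>m M)\<^sup>T = det A \<cdot>\<^sub>m M\<^sup>T" by (intro eq_matI) auto
  have "adj_cov n (fst \<theta>) (snd \<theta>) = (det A \<cdot>\<^sub>m M)\<^sup>T * snd \<theta> * (det A \<cdot>\<^sub>m M)"
    unfolding adj_cov_def A_def[symmetric] adj_mat_eq_mat_inv[OF A] M_def ..
  also have "\<dots> = det A \<cdot>\<^sub>m (M\<^sup>T * snd \<theta>) * (det A \<cdot>\<^sub>m M)"
    unfolding tr using M Om by (simp add: mult_smult_assoc_mat[of _ n n _ n])
  also have "\<dots> = det A \<cdot>\<^sub>m (det A \<cdot>\<^sub>m phiG n \<theta>)"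
    unfolding phi using M Om
    by (simp add: mult_smult_assoc_mat[of _ n n _ n] mult_smult_distrib[of _ n n _ n] mult_carrier_mat[of _ n n _ n])
  finally have eq: "adj_cov n (fst \<theta>) (snd \<theta>) = det A \<cdot>\<^sub>m (det A \<cdot>\<^sub>m phiG n \<theta>)" .
  have P: "phiG n \<theta> \<in> carrier_mat n n" unfolding phi using M Om by (auto intro!: mult_carrier_mat)
  show ?thesis unfolding eq using P d assms by (simp add: subdet_smult[of _ n])
qed

theorem theorem3p8:
  fixes n :: nat and D B :: "(nat \<times> nat) set" and v w0 :: nat and ws :: "nat list"
    and S T :: "nat set" and k :: nat
  assumes G: "mixed_graph n D B"
    and v: "v < n"
    and e0: "(w0, v) \<in> D"
    and ews: "\<forall>w \<in> set ws. (w, v) \<in> D"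
    and dist: "distinct (w0 # ws)"
    and S: "S \<subseteq> {0..<n}"
    and T: "T \<subseteq> {0..<n} - {v, w0}"
    and k: "card S = k" "card T + 1 = k"
    and a: "des D v \<inter> (T \<union> {v}) = {}"
    and b: "max_flow (Gflow_verts n) (Gflow_edges n D B) (Inl ` S) (Inr ` (T \<union> {w0})) = real k"
    and c: "max_flow (Gflow_verts n) (Gflow_edges n D B - {(Inr w, Inr v) | w. w \<in> set (w0 # ws)})
              (Inl ` S) (Inr ` (T \<union> {v})) < real k"
  shows
   "((\<forall>w \<in> set ws. generically_identifiable n D B w v) \<longrightarrow>
       generically_identifiable n D B w0 v \<and>
       (\<forall>ss ts. distinct ss \<and> set ss = S \<and> distinct ts \<and> set ts = T \<longrightarrow>
          (\<exists>A. proper_algebraic_subset (Theta n D B) A \<and>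
             (\<forall>\<theta> \<in> Theta n D B - A.
                subdet (phiG n \<theta>) ss (ts @ [w0]) \<noteq> 0 \<and>
                fst \<theta> $$ (w0, v) =
                  (subdet (phiG n \<theta>) ss (ts @ [v])
                    - (\<Sum>i<length ws. fst \<theta> $$ (ws ! i, v) * subdet (phiG n \<theta>) ss (ts @ [ws ! i])))
                  / subdet (phiG n \<theta>) ss (ts @ [w0])))))
    \<and>
    ((\<forall>w \<in> set ws. rationally_identifiable n D B w v) \<longrightarrow>
       rationally_identifiable n D B w0 v \<and>
       (\<forall>ss ts. distinct ss \<and> set ss = S \<and> distinct ts \<and> set ts = T \<longrightarrow>
          (\<exists>A. proper_algebraic_subset (Theta n D B) A \<and>
             (\<forall>\<theta> \<in> Theta n D B - A.
                subdet (phiG n \<theta>) ss (ts @ [w0]) \<noteq> 0 \<and>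
                fst \<theta> $$ (w0, v) =
                  (subdet (phiG n \<theta>) ss (ts @ [v])
                    - (\<Sum>i<length ws. fst \<theta> $$ (ws ! i, v) * subdet (phiG n \<theta>) ss (ts @ [ws ! i])))
                  / subdet (phiG n \<theta>) ss (ts @ [w0])))))"
proof -
  define W where "W = Gflow_verts n"
  define E where "E = Gflow_edges n D B"
  define E' where "E' = E - {(Inr w, Inr v) | w. w \<in> set (w0 # ws)}"
  have D: "D \<subseteq> {0..<n} \<times> {0..<n}" and noloop: "(v,v) \<notin> D" using G by (auto simp: mixed_graph_def)
  have w0: "w0 < n" "w0 \<noteq> v" "w0 \<notin> T" using e0 D noloop T by auto
  have vT: "v \<notin> T" using T by auto
  have finW: "finite W" by (simp add: W_def Gflow_verts_def)
  have EW: "E \<subseteq> W \<times> W" "E' \<subseteq> W \<times> W" using Gflow_edges_subset[OF G] by (auto simp: W_def E_def E'_def)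
  have SW: "Inl ` S \<subseteq> W" using S by (auto simp: W_def Gflow_verts_def)
  have TW: "Inr ` (T \<union> {w0}) \<subseteq> W" "Inr ` (T \<union> {v}) \<subseteq> W"
    using T w0 v by (auto simp: W_def Gflow_verts_def)
  have finT: "finite T" using T by (rule finite_subset) simp
  have card: "card (Inl ` S :: (nat + nat) set) = k" "card (Inr ` (T \<union> {w0}) :: (nat + nat) set) = k"
      "card (Inr ` (T \<union> {v}) :: (nat + nat) set) = k"
    using k finT w0 vT by (simp_all add: card_image card_insert_if image_iff)
  \<comment> \<open>A Hall violator would push the maximum flow below \<open>k\<close>, against
    \<open>b\<close>, so there is a matching.\<close>
  obtain \<sigma> where \<sigma>: "bij_betw \<sigma> (W - Inr ` (T \<union> {w0})) (W - Inl ` S)"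
      "\<And>r. r \<in> W - Inr ` (T \<union> {w0}) \<Longrightarrow> \<sigma> r = r \<or> (r, \<sigma> r) \<in> E"
  proof -
    have "\<not> card (R \<union> E `` R - Inl ` S) < card R" if "R \<subseteq> W - Inr ` (T \<union> {w0})" for R
      using max_flow_hall_violator[OF finW EW(1) SW that] b card by (auto simp: W_def E_def)
    then show ?thesis
      using matching_or_hall_violator[OF finW EW(1) SW TW(1)] card that by metis
  qed
  \<comment> \<open>A matching in the reduced graph would give a flow of value \<open>k\<close>,
    against \<open>c\<close>.\<close>
  obtain R where R: "R \<subseteq> W - Inr ` (T \<union> {v})" "card (R \<union> E' `` R - Inl ` S) < card R"
  proof -
    have "\<not> (bij_betw \<sigma> (W - Inr ` (T \<union> {v})) (W - Inl ` S) \<and>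
        (\<forall>r\<in>W - Inr ` (T \<union> {v}). \<sigma> r = r \<or> (r, \<sigma> r) \<in> E'))" for \<sigma>
      using max_flow_of_matching[OF finW SW TW(2), of \<sigma> E'] c card by (auto simp: W_def E_def E'_def)
    then show ?thesis
      using matching_or_hall_violator[OF finW EW(2) SW TW(2)] card that by metis
  qed

  \<comment> \<open>This holds at every parameter, with no genericity, and so can be applied to
    \<open>\<theta>\<close> and to any \<open>\<theta>'\<close> with the same covariance
    matrix.\<close>
  have identity: "subdet (phiG n \<theta>) ss (ts @ [v])
      = fst \<theta> $$ (w0,v) * subdet (phiG n \<theta>) ss (ts @ [w0])
        + (\<Sum>i<length ws. fst \<theta> $$ (ws ! i, v) * subdet (phiG n \<theta>) ss (ts @ [ws ! i]))"
    if \<theta>: "\<theta> \<in> Theta n D B" and ss: "distinct ss" "set ss = S" and ts: "distinct ts" "set ts = T"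
    for \<theta> ss ts
  proof -
    define Sig where "Sig = phiG n \<theta>"
    define y where "y = (\<lambda>s. Sig $$ (s,v) - (\<Sum>w\<in>set (w0 # ws). fst \<theta> $$ (w,v) * Sig $$ (s,w)))"
    have len: "length ss = Suc (length ts)" using k ss ts by (metis Suc_eq_plus1 distinct_card)
    have sumS: "(\<Sum>i<length ss. f (ss ! i)) = sum f S" for f :: "nat \<Rightarrow> real"
      using sum.reindex_bij_betw[OF bij_betw_nth[OF ss(1) refl ss(2)[symmetric]], of f] by simp
    have parents: "(w,v) \<in> D" if "w \<in> set (w0 # ws)" for w using that e0 ews by auto
    have T': "T \<subseteq> {0..<n} - {v}" using T by auto
    obtain a where a: "\<exists>s\<in>S. a s \<noteq> 0" "\<And>t. t \<in> T \<Longrightarrow> (\<Sum>s\<in>S. a s * Sig $$ (s,t)) = 0"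
        "(\<Sum>s\<in>S. a s * y s) = 0"
      using cov_left_null_vector[OF G \<theta> v parents S T' a E'_def[unfolded E_def] R[unfolded W_def]]
      unfolding Sig_def y_def by blast
    obtain C where C: "\<And>w. subdet Sig ss (ts @ [w]) = (\<Sum>i<length ss. C i * Sig $$ (ss ! i, w))"
        "\<And>y. det (mat (length ss) (length ss) (\<lambda>(i,j). if j < length ts then Sig $$ (ss ! i, ts ! j) else y i))
          = (\<Sum>i<length ss. C i * y i)"
      using subdet_append_column_linear[OF len, of Sig] by blast
    \<comment> \<open>\<open>a\<close> annihilates the columns \<open>T\<close> and the modified
      column \<open>y\<close>.\<close>
    have "det (mat (length ss) (length ss)
        (\<lambda>(i,j). if j < length ts then Sig $$ (ss ! i, ts ! j) else y (ss ! i))) = 0"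
      unfolding det_mat_eq_0_iff
    proof (intro exI[of _ "\<lambda>i. a (ss ! i)"] conjI allI impI)
      show "\<exists>i<length ss. a (ss ! i) \<noteq> 0" using a(1) ss(2) by (metis in_set_conv_nth)
      fix j assume "j < length ss"
      show "(\<Sum>i<length ss. a (ss ! i) * (if j < length ts then Sig $$ (ss ! i, ts ! j) else y (ss ! i))) = 0"
      proof (cases "j < length ts")
        case True
        then have "ts ! j \<in> T" using ts(2) by auto
        then show ?thesis using True a(2) sumS[of "\<lambda>s. a s * Sig $$ (s, ts ! j)"] by simp
      next
        case False
        then show ?thesis using a(3) sumS[of "\<lambda>s. a s * y s"] by simp
      qed
    qed
    then have "0 = (\<Sum>i<length ss. C i * y (ss ! i))" using C(2) by simp
    also have "\<dots> = subdet Sig ss (ts @ [v])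
        - (\<Sum>i<length ss. \<Sum>w\<in>set (w0 # ws). fst \<theta> $$ (w,v) * (C i * Sig $$ (ss ! i, w)))"
      unfolding C(1) y_def by (simp only: right_diff_distrib sum_subtractf sum_distrib_left mult.left_commute)
    also have "(\<Sum>i<length ss. \<Sum>w\<in>set (w0 # ws). fst \<theta> $$ (w,v) * (C i * Sig $$ (ss ! i, w)))
        = (\<Sum>w\<in>set (w0 # ws). fst \<theta> $$ (w,v) * subdet Sig ss (ts @ [w]))"
      unfolding C(1) by (subst sum.swap) (simp only: sum_distrib_left)
    also have "\<dots> = fst \<theta> $$ (w0,v) * subdet Sig ss (ts @ [w0])
        + (\<Sum>w\<in>set ws. fst \<theta> $$ (w,v) * subdet Sig ss (ts @ [w]))"
      using dist by simp
    also have "(\<Sum>w\<in>set ws. fst \<theta> $$ (w,v) * subdet Sig ss (ts @ [w]))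
        = (\<Sum>i<length ws. fst \<theta> $$ (ws ! i, v) * subdet Sig ss (ts @ [ws ! i]))"
      using dist sum.reindex_bij_betw[OF bij_betw_nth[OF _ refl refl], of ws
          "\<lambda>w. fst \<theta> $$ (w,v) * subdet Sig ss (ts @ [w])"] by simp
    finally show ?thesis by (simp add: Sig_def)
  qed

  \<comment> \<open>A polynomial with the same zeros on \<open>Theta\<close> as the
    denominator.\<close>
  define g where "g = (\<lambda>ss ts \<theta>. subdet (adj_cov n (mat_trunc n (fst \<theta>)) (mat_trunc n (snd \<theta>))) ss (ts @ [w0]))"
  have g: "polyfun param_coords (g ss ts) \<and> (\<exists>\<theta>\<in>Theta n D B. g ss ts \<theta> \<noteq> 0) \<and>
      (\<forall>\<theta>\<in>Theta n D B. g ss ts \<theta> \<noteq> 0 \<longleftrightarrow> subdet (phiG n \<theta>) ss (ts @ [w0]) \<noteq> 0)"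
    if ss: "distinct ss" "set ss = S" and ts: "distinct ts" "set ts = T" for ss ts
  proof -
    have len: "length ss = length (ts @ [w0])" using k ss ts by (metis distinct_card length_append_singleton Suc_eq_plus1)
    have ts': "distinct (ts @ [w0])" "set (ts @ [w0]) = T \<union> {w0}" "set (ts @ [w0]) \<subseteq> {0..<n}"
      using ts w0 T by auto
    have ss': "set ss \<subseteq> {0..<n}" using ss S by simp
    have g_eq: "g ss ts \<theta> = subdet (adj_cov n (fst \<theta>) (snd \<theta>)) ss (ts @ [w0])" if "\<theta> \<in> Theta n D B" for \<theta>
    proof -
      have "fst \<theta> \<in> carrier_mat n n" "snd \<theta> \<in> carrier_mat n n"
        using that by (auto simp: Theta_def RD_reg_def PD_B_def pos_def_mat_def)
      then show ?thesis by (simp add: g_def mat_trunc_id)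
    qed
    have "\<exists>\<theta>\<in>Theta n D B. subdet (adj_cov n (fst \<theta>) (snd \<theta>)) ss (ts @ [w0]) \<noteq> 0"
      by (rule ex_adj_cov_minor_nonzero[OF G ss(1) ss' ts'(1,3) len, unfolded ss(2) ts'(2),
            OF \<sigma>[unfolded W_def E_def]])
    moreover have "polyfun param_coords (g ss ts)"
      unfolding g_def by (rule polyfun_adj_cov_minor[OF ss' ts'(3) len])
    ultimately show ?thesis
      using g_eq adj_cov_minor_iff[OF _ ss' ts'(3) len] by auto
  qed

  have formula: "\<forall>ss ts. distinct ss \<and> set ss = S \<and> distinct ts \<and> set ts = T \<longrightarrow>
          (\<exists>A. proper_algebraic_subset (Theta n D B) A \<and>
             (\<forall>\<theta> \<in> Theta n D B - A.
                subdet (phiG n \<theta>) ss (ts @ [w0]) \<noteq> 0 \<and>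
                fst \<theta> $$ (w0, v) =
                  (subdet (phiG n \<theta>) ss (ts @ [v])
                    - (\<Sum>i<length ws. fst \<theta> $$ (ws ! i, v) * subdet (phiG n \<theta>) ss (ts @ [ws ! i])))
                  / subdet (phiG n \<theta>) ss (ts @ [w0])))" (is "\<forall>ss ts. _ \<longrightarrow> ?P ss ts")
  proof (intro allI impI)
    fix ss ts assume *: "distinct ss \<and> set ss = S \<and> distinct ts \<and> set ts = T"
    then have gs: "polyfun param_coords (g ss ts)" "\<exists>\<theta>\<in>Theta n D B. g ss ts \<theta> \<noteq> 0"
      "\<And>\<theta>. \<theta> \<in> Theta n D B \<Longrightarrow> g ss ts \<theta> \<noteq> 0 \<longleftrightarrow> subdet (phiG n \<theta>) ss (ts @ [w0]) \<noteq> 0"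
      using g[of ss ts] by auto
    have "proper_algebraic_subset (Theta n D B) {\<theta> \<in> Theta n D B. g ss ts \<theta> = 0}"
      using gs(1,2) polyfun_hypersurface_proper by blast
    moreover have "subdet (phiG n \<theta>) ss (ts @ [w0]) \<noteq> 0 \<and>
                fst \<theta> $$ (w0, v) =
                  (subdet (phiG n \<theta>) ss (ts @ [v])
                    - (\<Sum>i<length ws. fst \<theta> $$ (ws ! i, v) * subdet (phiG n \<theta>) ss (ts @ [ws ! i])))
                  / subdet (phiG n \<theta>) ss (ts @ [w0])"
      if "\<theta> \<in> Theta n D B - {\<theta> \<in> Theta n D B. g ss ts \<theta> = 0}" for \<theta>
    proof -
      have \<theta>: "\<theta> \<in> Theta n D B" "subdet (phiG n \<theta>) ss (ts @ [w0]) \<noteq> 0" using that gs(3) by auto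
      then show ?thesis using identity[OF \<theta>(1), of ss ts] * by (simp add: field_simps)
    qed
    ultimately show "?P ss ts" by blast
  qed

  define ss where "ss = sorted_list_of_set S"
  define ts where "ts = sorted_list_of_set T"
  have finS: "finite S" using S by (rule finite_subset) simp
  have st: "distinct ss" "set ss = S" "distinct ts" "set ts = T"
    using finS finT by (auto simp: ss_def ts_def)
  note g' = g[OF st] and identity' = identity[OF _ st]

  have generic: "generically_identifiable n D B w0 v"
    if id: "\<forall>w \<in> set ws. generically_identifiable n D B w v"
  proof -
    define Q where "Q = (\<lambda>w \<theta>. \<forall>\<theta>' \<in> Theta n D B. phiG n \<theta>' = phiG n \<theta> \<longrightarrow> fst \<theta>' $$ (w,v) = fst \<theta> $$ (w,v))"
    have "\<forall>w\<in>set ws. \<exists>A. proper_algebraic_subset (Theta n D B) A \<and> (\<forall>\<theta>\<in>Theta n D B - A. Q w \<theta>)"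
      using id by (simp add: generically_identifiable_def Q_def)
    from common_generic_polyfun[OF this conjunct1[OF g'] conjunct1[OF conjunct2[OF g']]]
    obtain f where f: "polyfun param_coords f" "\<exists>\<theta>\<in>Theta n D B. f \<theta> \<noteq> 0"
      "\<And>\<theta>. \<theta> \<in> Theta n D B \<Longrightarrow> f \<theta> \<noteq> 0 \<Longrightarrow> g ss ts \<theta> \<noteq> 0 \<and> (\<forall>w\<in>set ws. Q w \<theta>)"
      by blast
    \<comment> \<open>Only \<open>\<theta>\<close> has to be generic. Both points share all minors
      and, by the choice of \<open>f\<close>, the weights of \<open>ws\<close>; the identity at each
      then fixes the remaining weight, as the denominator is nonzero.\<close>
    have "fst \<theta>' $$ (w0,v) = fst \<theta> $$ (w0,v)"
      if \<theta>: "\<theta> \<in> Theta n D B - {\<theta>\<in>Theta n D B. f \<theta> = 0}" "\<theta>' \<in> Theta n D B" "phiG n \<theta>' = phiG n \<theta>" for \<theta> \<theta>'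
    proof -
      have th: "\<theta> \<in> Theta n D B" "f \<theta> \<noteq> 0" using \<theta>(1) by auto
      have nz: "subdet (phiG n \<theta>) ss (ts @ [w0]) \<noteq> 0" using f(3)[OF th] g' th by blast
      have "fst \<theta>' $$ (ws ! i, v) = fst \<theta> $$ (ws ! i, v)" if "i < length ws" for i
        using f(3)[OF th] \<theta>(2,3) nth_mem[OF that] unfolding Q_def by blast
      then have "fst \<theta>' $$ (w0,v) * subdet (phiG n \<theta>) ss (ts @ [w0])
          = fst \<theta> $$ (w0,v) * subdet (phiG n \<theta>) ss (ts @ [w0])"
        using identity'[OF th(1)] identity'[OF \<theta>(2)] unfolding \<theta>(3) by simp
      then show ?thesis using nz by simp
    qed
    moreover have "proper_algebraic_subset (Theta n D B) {\<theta>\<in>Theta n D B. f \<theta> = 0}"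
      using f(1,2) polyfun_hypersurface_proper by blast
    ultimately show ?thesis unfolding generically_identifiable_def by blast
  qed

  have rational: "rationally_identifiable n D B w0 v"
    if id: "\<forall>w \<in> set ws. rationally_identifiable n D B w v"
  proof -
    obtain p q where pq: "\<And>w. w \<in> set ws \<Longrightarrow> polyfun mat_coords (p w) \<and> polyfun mat_coords (q w) \<and>
        (\<exists>A. proper_algebraic_subset (Theta n D B) A \<and>
          (\<forall>\<theta> \<in> Theta n D B - A. q w (phiG n \<theta>) \<noteq> 0 \<and> p w (phiG n \<theta>) / q w (phiG n \<theta>) = fst \<theta> $$ (w,v)))"
      using id unfolding rationally_identifiable_def by metis
    define Q where "Q = (\<lambda>w \<theta>. q w (phiG n \<theta>) \<noteq> 0 \<and> p w (phiG n \<theta>) / q w (phiG n \<theta>) = fst \<theta> $$ (w,v))"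
    have "\<forall>w\<in>set ws. \<exists>A. proper_algebraic_subset (Theta n D B) A \<and> (\<forall>\<theta>\<in>Theta n D B - A. Q w \<theta>)"
      using pq by (simp add: Q_def)
    from common_generic_polyfun[OF this conjunct1[OF g'] conjunct1[OF conjunct2[OF g']]]
    obtain f where f: "polyfun param_coords f" "\<exists>\<theta>\<in>Theta n D B. f \<theta> \<noteq> 0"
      "\<And>\<theta>. \<theta> \<in> Theta n D B \<Longrightarrow> f \<theta> \<noteq> 0 \<Longrightarrow> g ss ts \<theta> \<noteq> 0 \<and> (\<forall>w\<in>set ws. Q w \<theta>)"
      by blast
    have len: "length ss = length (ts @ [w])" for w
      using k st by (metis distinct_card length_append_singleton Suc_eq_plus1)
    have pm: "polyfun mat_coords (\<lambda>M. M $$ (i,j))" for i j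
      using pvar[of mat_coords "(i,j)"] by (simp add: mat_coords_def)
    have pd: "polyfun mat_coords (\<lambda>M. subdet M ss (ts @ [w]))" for w
      by (rule polyfun_subdet[OF pm len])
    obtain P R where PR: "polyfun mat_coords P" "polyfun mat_coords R"
      "\<And>M. (\<forall>w\<in>set ws. q w M \<noteq> 0) \<Longrightarrow>
        R M \<noteq> 0 \<and> P M / R M = (\<Sum>w\<leftarrow>ws. p w M / q w M * subdet M ss (ts @ [w]))"
      using rational_combination[of ws mat_coords p q "\<lambda>w M. subdet M ss (ts @ [w])"] pq pd by blast
    \<comment> \<open>The formula for the weight with the sum over \<open>ws\<close> written as
      \<open>P / R\<close>, then numerator and denominator multiplied by \<open>R\<close>.\<close>
    have "R (phiG n \<theta>) * subdet (phiG n \<theta>) ss (ts @ [w0]) \<noteq> 0 \<and>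
        (subdet (phiG n \<theta>) ss (ts @ [v]) * R (phiG n \<theta>) - P (phiG n \<theta>))
          / (R (phiG n \<theta>) * subdet (phiG n \<theta>) ss (ts @ [w0])) = fst \<theta> $$ (w0,v)"
      if \<theta>: "\<theta> \<in> Theta n D B - {\<theta>\<in>Theta n D B. f \<theta> = 0}" for \<theta>
    proof -
      have th: "\<theta> \<in> Theta n D B" "f \<theta> \<noteq> 0" using \<theta> by auto
      define M where "M = phiG n \<theta>"
      have nz: "subdet M ss (ts @ [w0]) \<noteq> 0" using f(3)[OF th] g' th unfolding M_def by blast
      have q: "q w M \<noteq> 0" "p w M / q w M = fst \<theta> $$ (w,v)" if "w \<in> set ws" for w
        using f(3)[OF th] that by (auto simp: Q_def M_def)
      have RM: "R M \<noteq> 0" and "P M / R M = (\<Sum>w\<leftarrow>ws. p w M / q w M * subdet M ss (ts @ [w]))"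
        using PR(3)[of M] q(1) by auto
      note this(2)
      also have "(\<Sum>w\<leftarrow>ws. p w M / q w M * subdet M ss (ts @ [w]))
          = (\<Sum>w\<leftarrow>ws. fst \<theta> $$ (w,v) * subdet M ss (ts @ [w]))"
        using q(2) by (intro arg_cong[of _ _ sum_list] map_cong) auto
      also have "\<dots> = (\<Sum>i<length ws. fst \<theta> $$ (ws ! i, v) * subdet M ss (ts @ [ws ! i]))"
        by (simp add: sum_list_sum_nth lessThan_atLeast0)
      finally have "subdet M ss (ts @ [v]) = fst \<theta> $$ (w0,v) * subdet M ss (ts @ [w0]) + P M / R M"
        using identity'[OF th(1)] by (simp add: M_def)
      then show ?thesis using nz RM unfolding M_def[symmetric] by (simp add: field_simps)
    qed
    moreover have "proper_algebraic_subset (Theta n D B) {\<theta>\<in>Theta n D B. f \<theta> = 0}"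
      using f(1,2) polyfun_hypersurface_proper by blast
    moreover have "polyfun mat_coords (\<lambda>M. subdet M ss (ts @ [v]) * R M - P M)"
      "polyfun mat_coords (\<lambda>M. R M * subdet M ss (ts @ [w0]))"
      using pd PR(1,2) by (auto intro!: polyfun_diff pmult)
    ultimately show ?thesis unfolding rationally_identifiable_def by blast
  qed

  show ?thesis using formula generic rational by blast
qed

end
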